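(* For any directed graph $G=(V,E)$ with $n$ vertices and any set $\mathcal{P}\subseteq V\times V$ of vertex pairs, there exists a 2-fault-tolerant reachability subgraph with slack for $(G,\mathcal{P})$ having at most $O(n^{4/3}|\mathcal{P}|^{1/3})$ edges. Furthermore, such a subgraph can be found in polynomial time.
   Context: A subgraph $H$ of $G$ is a $k$-fault-tolerant reachability subgraph of $G$ for a pair set $\mathcal{Q}$ if for every $(s,t)\in\mathcal{Q}$ and every $F\subseteq E$ with $|F|\le k$, $t$ is reachable from $s$ in $G\setminus F$ iff $t$ is reachable from $s$ in $H\setminus F$. $H$ is a $k$-fault-tolerant reachability subgraph with slack for $(G,\mathcal{P})$ if there exists $\mathcal{P}'\subseteq\mathcal{P}$ with $|\mathcal{P}'|=\Omega(|\mathcal{P}|)$ such that $H$ is a $k$-fault-tolerant reachability subgraph of $G$ for $\mathcal{P}'$. *)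

theory Defs
  imports
    Complex_Main
    "HOL-Computational_Algebra.Polynomial"
    "Graph_Theory.Graph_Theory"
begin

section \<open>Fault-tolerant reachability subgraphs\<close>

definition without_arcs :: "'a pair_pre_digraph \<Rightarrow> ('a \<times> 'a) set \<Rightarrow> 'a pair_pre_digraph" where
  "without_arcs G F = \<lparr> pverts = pverts G, parcs = parcs G - F \<rparr>"

definition ft_reach_subgraph ::
  "nat \<Rightarrow> 'a pair_pre_digraph \<Rightarrow> ('a \<times> 'a) set \<Rightarrow> 'a pair_pre_digraph \<Rightarrow> bool" where
  "ft_reach_subgraph k G Q H \<longleftrightarrow>
     subgraph (with_proj H) (with_proj G) \<and>
     (\<forall>(s, t) \<in> Q. \<forall>F. F \<subseteq> parcs G \<and> finite F \<and> card F \<le> k \<longrightarrow>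
        (s \<rightarrow>\<^sup>*\<^bsub>with_proj (without_arcs G F)\<^esub> t \<longleftrightarrow>
         s \<rightarrow>\<^sup>*\<^bsub>with_proj (without_arcs H F)\<^esub> t))"

text \<open>The parameter \<open>c\<close> is the constant hidden in \<open>|P'| = \<Omega>(|P|)\<close>.\<close>

definition ft_reach_subgraph_slack ::
  "real \<Rightarrow> nat \<Rightarrow> 'a pair_pre_digraph \<Rightarrow> ('a \<times> 'a) set \<Rightarrow> 'a pair_pre_digraph \<Rightarrow> bool" where
  "ft_reach_subgraph_slack c k G P H \<longleftrightarrow>
     (\<exists>P' \<subseteq> P. real (card P') \<ge> c * real (card P) \<and> ft_reach_subgraph k G P' H)"


section \<open>A machine model for polynomial time\<close>

text \<open>
  Structured programs for a random access machine: scalar variables and arrays hold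
  natural numbers, and the only arithmetic operations are addition and truncated subtraction.
  Every operation costs one unit. Multiplication and shifts are deliberately not primitive:
  with addition and subtraction alone, \<open>t\<close> steps lengthen the binary representation of the
  largest number present by at most \<open>O(t)\<close> bits, so a polynomial number of unit-cost steps
  is the same as polynomial time on a Turing machine.
\<close>

type_synonym vname = string

datatype expr =
    Const nat
  | Var vname
  | Elem vname expr
  | Add expr expr
  | Sub expr expr

datatype prog =
    Skip
  | Assign vname expr
  | Store vname expr expr
  | Seq prog prog
  | Cond expr prog prog
  | While expr prog

record store =
  scalar :: "vname \<Rightarrow> nat"
  arr :: "vname \<Rightarrow> nat \<Rightarrow> nat"

primrec expr_val :: "expr \<Rightarrow> store \<Rightarrow> nat" where
  "expr_val (Const k) \<sigma> = k"
| "expr_val (Var x) \<sigma> = scalar \<sigma> x"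
| "expr_val (Elem a i) \<sigma> = arr \<sigma> a (expr_val i \<sigma>)"
| "expr_val (Add e e') \<sigma> = expr_val e \<sigma> + expr_val e' \<sigma>"
| "expr_val (Sub e e') \<sigma> = expr_val e \<sigma> - expr_val e' \<sigma>"

primrec expr_cost :: "expr \<Rightarrow> nat" where
  "expr_cost (Const k) = 1"
| "expr_cost (Var x) = 1"
| "expr_cost (Elem a i) = 1 + expr_cost i"
| "expr_cost (Add e e') = 1 + expr_cost e + expr_cost e'"
| "expr_cost (Sub e e') = 1 + expr_cost e + expr_cost e'"

definition set_scalar :: "vname \<Rightarrow> nat \<Rightarrow> store \<Rightarrow> store" where
  "set_scalar x k \<sigma> = \<sigma>\<lparr> scalar := (scalar \<sigma>)(x := k) \<rparr>"

definition set_elem :: "vname \<Rightarrow> nat \<Rightarrow> nat \<Rightarrow> store \<Rightarrow> store" where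
  "set_elem a i k \<sigma> = \<sigma>\<lparr> arr := (arr \<sigma>)(a := (arr \<sigma> a)(i := k)) \<rparr>"

text \<open>
  \<open>exec p \<sigma> t \<tau>\<close>: started in \<open>\<sigma>\<close>, the program \<open>p\<close> halts in \<open>\<tau>\<close> after exactly \<open>t\<close> units of time.
  The relation is deterministic; a test succeeds iff the value is nonzero.
\<close>

inductive exec :: "prog \<Rightarrow> store \<Rightarrow> nat \<Rightarrow> store \<Rightarrow> bool" where
  exec_Skip: "exec Skip \<sigma> 1 \<sigma>"
| exec_Assign: "exec (Assign x e) \<sigma> (1 + expr_cost e) (set_scalar x (expr_val e \<sigma>) \<sigma>)"
| exec_Store: "exec (Store a i e) \<sigma> (1 + expr_cost i + expr_cost e)
    (set_elem a (expr_val i \<sigma>) (expr_val e \<sigma>) \<sigma>)"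
| exec_Seq: "exec p \<sigma> t \<sigma>' \<Longrightarrow> exec q \<sigma>' t' \<sigma>'' \<Longrightarrow> exec (Seq p q) \<sigma> (t + t') \<sigma>''"
| exec_Cond_True: "expr_val e \<sigma> \<noteq> 0 \<Longrightarrow> exec p \<sigma> t \<sigma>' \<Longrightarrow>
    exec (Cond e p q) \<sigma> (1 + expr_cost e + t) \<sigma>'"
| exec_Cond_False: "expr_val e \<sigma> = 0 \<Longrightarrow> exec q \<sigma> t \<sigma>' \<Longrightarrow>
    exec (Cond e p q) \<sigma> (1 + expr_cost e + t) \<sigma>'"
| exec_While_False: "expr_val e \<sigma> = 0 \<Longrightarrow> exec (While e p) \<sigma> (1 + expr_cost e) \<sigma>"
| exec_While_True: "expr_val e \<sigma> \<noteq> 0 \<Longrightarrow> exec p \<sigma> t \<sigma>' \<Longrightarrow> exec (While e p) \<sigma>' t' \<sigma>'' \<Longrightarrow>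
    exec (While e p) \<sigma> (1 + expr_cost e + t + t') \<sigma>''"

text \<open>
  A list of pairs is held in a scalar (its length) and two arrays (its first and second
  components). On input the edges are in \<open>m, Efst, Esnd\<close>, the demand pairs in
  \<open>q, Pfst, Psnd\<close> and the number of vertices in \<open>n\<close>; everything else is zero.
\<close>

definition nth_or_0 :: "nat list \<Rightarrow> nat \<Rightarrow> nat" where
  "nth_or_0 xs i = (if i < length xs then xs ! i else 0)"

definition input_store :: "nat \<Rightarrow> (nat \<times> nat) list \<Rightarrow> (nat \<times> nat) list \<Rightarrow> store" where
  "input_store n es ps =
     \<lparr> scalar = (\<lambda>_. 0)(''n'' := n, ''m'' := length es, ''q'' := length ps),
       arr = (\<lambda>_ _. 0)
         (''Efst'' := nth_or_0 (map fst es), ''Esnd'' := nth_or_0 (map snd es),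
          ''Pfst'' := nth_or_0 (map fst ps), ''Psnd'' := nth_or_0 (map snd ps)) \<rparr>"

definition output_list :: "store \<Rightarrow> (nat \<times> nat) list" where
  "output_list \<sigma> = map (\<lambda>i. (arr \<sigma> ''Hfst'' i, arr \<sigma> ''Hsnd'' i)) [0..<scalar \<sigma> ''h'']"

definition list_digraph :: "nat \<Rightarrow> (nat \<times> nat) list \<Rightarrow> nat pair_pre_digraph" where
  "list_digraph n es = \<lparr> pverts = {..<n}, parcs = set es \<rparr>"

text \<open>
  The edge lists contain no repetitions; for the output this also ensures that writing it out
  takes polynomial time. The input size is \<open>n + |E| + |P|\<close>.
\<close>

definition poly_time_constructs ::
  "(nat pair_pre_digraph \<Rightarrow> (nat \<times> nat) set \<Rightarrow> nat pair_pre_digraph \<Rightarrow> bool) \<Rightarrow> bool" where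
  "poly_time_constructs R \<longleftrightarrow>
     (\<exists>(p :: prog) (b :: nat poly). \<forall>n es ps.
        distinct es \<and> set es \<subseteq> {..<n} \<times> {..<n} \<and>
        distinct ps \<and> set ps \<subseteq> {..<n} \<times> {..<n} \<longrightarrow>
        (\<exists>t \<sigma>. exec p (input_store n es ps) t \<sigma> \<and>
           t \<le> poly b (n + length es + length ps) \<and>
           distinct (output_list \<sigma>) \<and>
           R (list_digraph n es) (set ps) (list_digraph n (output_list \<sigma>))))"

end

theory Submission
  imports Defs
begin

text \<open>
  No pairs are given up: an inclusion-minimal preserver already has \<open>O(n powr (4/3) * p powr (1/3))\<close>
  edges, where \<open>p\<close> is the number of pairs, and it is found by deleting edges greedily. In a minimal preserver every edge
  \<open>e\<close> is critical for some pair \<open>(s, t)\<close>: there is a set \<open>F\<close> of at most two faults such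
  that \<open>t\<close> is reachable in \<open>E - F\<close> but not in \<open>E - F - {e}\<close>. Fix such data for every \<open>e\<close>, and let the hubs of
  \<open>e\<close> be the vertices \<open>r\<close> with \<open>s \<rightarrow> r \<rightarrow> t\<close> in \<open>E - F\<close>. If \<open>r\<close> is a hub of \<open>e\<close>, then \<open>e\<close> is
  critical for \<open>(s, r)\<close> or for \<open>(r, t)\<close>, and only \<open>O(n)\<close> edges are critical with a given source or with a given
  target. Hence only \<open>O(n\<^sup>2 / x)\<close> edges have more than \<open>x\<close> hubs. The edges of one pair
  with at most \<open>x\<close> hubs number \<open>O(x\<^sup>2)\<close>: their cuts \<open>F \<union> {e}\<close> all meet one set of at most \<open>x\<close>
  edges connecting \<open>s\<close> to \<open>t\<close>, and after fixing the common edge there remain cuts of size two, of which there are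
  \<open>O(x)\<close>. The choice \<open>x = (n\<^sup>2 / p) powr (1/3)\<close> balances both counts.
\<close>

section \<open>Critical edges\<close>

text \<open>Cut the path at its first edge leaving \<open>S\<close>. Recording that the part before
  it stays inside \<open>S\<close> lets that part be shown to avoid every edge whose head lies
  outside \<open>S\<close>.\<close>

lemma rtrancl_exit:
  assumes "(x, y) \<in> R\<^sup>*" "x \<in> S" "y \<notin> S"
  shows "\<exists>a b. (x, a) \<in> (R \<inter> S \<times> S)\<^sup>* \<and> (a, b) \<in> R \<and> a \<in> S \<and> b \<notin> S \<and> (b, y) \<in> R\<^sup>*"
proof -
  have "((x, y) \<in> (R \<inter> S \<times> S)\<^sup>* \<and> y \<in> S) \<or>
    (\<exists>a b. (x, a) \<in> (R \<inter> S \<times> S)\<^sup>* \<and> (a, b) \<in> R \<and> a \<in> S \<and> b \<notin> S \<and> (b, y) \<in> R\<^sup>*)"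
    using assms(1)
  proof (induction rule: rtrancl_induct)
    case base
    then show ?case using assms(2) by blast
  next
    case (step y z)
    from step.IH show ?case
    proof
      assume y: "(x, y) \<in> (R \<inter> S \<times> S)\<^sup>* \<and> y \<in> S"
      show ?thesis
      proof (cases "z \<in> S")
        case True
        then have "(y, z) \<in> R \<inter> S \<times> S" using y step.hyps(2) by blast
        then show ?thesis using y True by (meson rtrancl.rtrancl_into_rtrancl)
      next
        case False
        then show ?thesis using y step.hyps(2) by blast
      qed
    next
      assume "\<exists>a b. (x, a) \<in> (R \<inter> S \<times> S)\<^sup>* \<and> (a, b) \<in> R \<and> a \<in> S \<and> b \<notin> S \<and> (b, y) \<in> R\<^sup>*"
      then show ?thesis using step.hyps(2) by (meson rtrancl.rtrancl_into_rtrancl)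
    qed
  qed
  then show ?thesis using assms(3) by blast
qed

text \<open>Let \<open>X\<close> be the set of vertices that \<open>s\<close> reaches without
  \<open>(u, w)\<close>. A path to \<open>t\<close> must leave \<open>X\<close>, and an edge leaving
  it other than \<open>(u, w)\<close> would enlarge \<open>X\<close>. So the path crosses
  \<open>(u, w)\<close> and continues from \<open>w\<close> to \<open>t\<close>.\<close>

lemma bridge_split:
  assumes "(s, t) \<in> R\<^sup>*" "(s, t) \<notin> (R - {(u, w)})\<^sup>*"
  shows "(s, u) \<in> (R - {(u, w)})\<^sup>*" "(u, w) \<in> R" "(s, w) \<notin> (R - {(u, w)})\<^sup>*" "(s, w) \<in> R\<^sup>*" "(w, t) \<in> R\<^sup>*"
proof -
  let ?X = "{v. (s, v) \<in> (R - {(u, w)})\<^sup>*}"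
  obtain a b where ab: "(a, b) \<in> R" "a \<in> ?X" "b \<notin> ?X" "(b, t) \<in> R\<^sup>*"
    using rtrancl_exit[of s t R ?X] assms by auto
  have "(a, b) = (u, w)"
  proof (rule ccontr)
    assume "(a, b) \<noteq> (u, w)"
    then have "(a, b) \<in> R - {(u, w)}" using ab by auto
    then show False using ab by (auto intro: rtrancl.rtrancl_into_rtrancl)
  qed
  then show "(s, u) \<in> (R - {(u, w)})\<^sup>*" "(u, w) \<in> R" "(s, w) \<notin> (R - {(u, w)})\<^sup>*" "(w, t) \<in> R\<^sup>*"
    using ab by auto
  then show "(s, w) \<in> R\<^sup>*"
    using rtrancl_mono[of "R - {(u, w)}" R] by (blast intro: rtrancl.rtrancl_into_rtrancl)
qed

definition critical :: "nat \<Rightarrow> ('a \<times> 'a) set \<Rightarrow> 'a \<Rightarrow> 'a \<Rightarrow> ('a \<times> 'a) set" where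
  "critical k E s t =
     {e. \<exists>F. finite F \<and> card F \<le> k \<and> (s, t) \<in> (E - F)\<^sup>* \<and> (s, t) \<notin> (E - F - {e})\<^sup>*}"

lemma criticalI:
  "finite F \<Longrightarrow> card F \<le> k \<Longrightarrow> (s, t) \<in> (E - F)\<^sup>* \<Longrightarrow> (s, t) \<notin> (E - F - {e})\<^sup>* \<Longrightarrow> e \<in> critical k E s t"
  unfolding critical_def by blast

lemma critical_subset: "critical k E s t \<subseteq> E"
proof
  fix e assume "e \<in> critical k E s t"
  then obtain F where "(s, t) \<in> (E - F)\<^sup>*" "(s, t) \<notin> (E - F - {e})\<^sup>*"
    unfolding critical_def by blast
  then show "e \<in> E" by (cases "e \<in> E") (auto simp: Diff_insert0)
qed

text \<open>By \<open>bridge_split\<close>, the faults that make the edge a bridge towards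
  \<open>t\<close> make it a bridge towards \<open>w\<close> as well. The critical edges of a source
  can thus be counted separately at each head.\<close>

lemma critical_head:
  assumes "(u, w) \<in> critical k E s t"
  shows "(u, w) \<in> critical k E s w"
proof -
  obtain F where F: "finite F" "card F \<le> k" "(s, t) \<in> (E - F)\<^sup>*" "(s, t) \<notin> (E - F - {(u, w)})\<^sup>*"
    using assms unfolding critical_def by blast
  then show ?thesis using bridge_split(3,4)[OF F(3,4)] by (intro criticalI)
qed

text \<open>Reversing all edges exchanges sources and targets, so bounds for a fixed source carry
  over to a fixed target.\<close>

lemma critical_converse: "(u, w) \<in> critical k E s t \<longleftrightarrow> (w, u) \<in> critical k (E\<inverse>) t s"
proof -
  have *: "(w, u) \<in> critical k (E\<inverse>) t s" if c: "(u, w) \<in> critical k E s t" for u w s t and E :: "('a \<times> 'a) set"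
  proof -
    obtain F where F: "finite F" "card F \<le> k" "(s, t) \<in> (E - F)\<^sup>*" "(s, t) \<notin> (E - F - {(u, w)})\<^sup>*"
      using c unfolding critical_def by blast
    have eq: "E\<inverse> - F\<inverse> = (E - F)\<inverse>" "(E - F)\<inverse> - {(w, u)} = (E - F - {(u, w)})\<inverse>" by auto
    show ?thesis
    proof (rule criticalI)
      show "finite (F\<inverse>)" "card (F\<inverse>) \<le> k" using F(1,2) by simp_all
      show "(t, s) \<in> (E\<inverse> - F\<inverse>)\<^sup>*" unfolding eq using F(3) by (rule rtrancl_converseI)
      show "(t, s) \<notin> (E\<inverse> - F\<inverse> - {(w, u)})\<^sup>*"
        unfolding eq using F(4) by (meson rtrancl_converseD)
    qed
  qed
  show ?thesis using *[of u w E s t] *[of w u "E\<inverse>" t s] unfolding converse_converse by (rule iffI)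
qed

section \<open>Cuts and the critical edges that enter a vertex\<close>

definition out_edges :: "('a \<times> 'a) set \<Rightarrow> 'a set \<Rightarrow> ('a \<times> 'a) set" where
  "out_edges E S = {(u, v) \<in> E. u \<in> S \<and> v \<notin> S}"

text \<open>Every edge leaving \<open>S \<inter> T\<close> or \<open>S \<union> T\<close> leaves
  \<open>S\<close> or \<open>T\<close>, and an edge leaving both of the former leaves both of the
  latter. Add the two resulting inequalities.\<close>

lemma out_edges_submodular:
  assumes "finite E"
  shows "card (out_edges E (S \<inter> T)) + card (out_edges E (S \<union> T)) \<le> card (out_edges E S) + card (out_edges E T)"
proof -
  have fin: "finite (out_edges E X)" for X
    using assms by (rule finite_subset[rotated]) (auto simp: out_edges_def)
  have "card (out_edges E (S \<inter> T) \<union> out_edges E (S \<union> T)) \<le> card (out_edges E S \<union> out_edges E T)"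
    by (rule card_mono) (use fin in \<open>auto simp: out_edges_def\<close>)
  moreover have "card (out_edges E (S \<inter> T) \<inter> out_edges E (S \<union> T)) \<le> card (out_edges E S \<inter> out_edges E T)"
    by (rule card_mono) (use fin in \<open>auto simp: out_edges_def\<close>)
  ultimately show ?thesis
    using card_Un_Int[OF fin fin, of "S \<inter> T" "S \<union> T"] card_Un_Int[OF fin fin, of S T] by linarith
qed

text \<open>A whole set of sources is allowed because the induction below adds sources one at a
  time.\<close>

definition critical_into :: "nat \<Rightarrow> ('a \<times> 'a) set \<Rightarrow> 'a set \<Rightarrow> 'a \<Rightarrow> ('a \<times> 'a) set" where
  "critical_into k E A w =
     {e \<in> E. snd e = w \<and> (\<exists>F. finite F \<and> card F \<le> k \<and> w \<in> (E - F)\<^sup>* `` A \<and> w \<notin> (E - F - {e})\<^sup>* `` A)}"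

text \<open>
  Induction on the minimum cut between \<open>A\<close> and \<open>w\<close>. Take a minimum cut \<open>S\<close> that is as large as
  possible. A path that shows \<open>e\<close> to be critical leaves \<open>S\<close> through one of its at most \<open>k + 1\<close> edges
  \<open>(a, b)\<close>, so \<open>e\<close> stays critical when \<open>b\<close> is added to the sources, and by maximality of \<open>S\<close>
  this increases the minimum cut.
\<close>

lemma card_critical_into:
  assumes "finite V" "E \<subseteq> V \<times> V" "A \<subseteq> V" "w \<notin> A"
    and "\<And>S. A \<subseteq> S \<Longrightarrow> S \<subseteq> V \<Longrightarrow> w \<notin> S \<Longrightarrow> j \<le> card (out_edges E S)"
  shows "card (critical_into k E A w) \<le> (k + 1) ^ (k + 2 - j)"
  using assms(3-)
proof (induction "k + 2 - j" arbitrary: A j)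
  case 0
  have fE: "finite E" using assms(1,2) by (intro finite_subset[OF assms(2)]) simp
  have "critical_into k E A w = {}"
  proof (rule ccontr)
    assume "critical_into k E A w \<noteq> {}"
    then obtain e F where F: "finite F" "card F \<le> k" "w \<notin> (E - F - {e})\<^sup>* `` A"
      unfolding critical_into_def by blast
    \<comment> \<open>The vertices still reachable form a cut whose outgoing edges all lie in
      \<open>insert e F\<close>: at most \<open>k + 1\<close> edges, fewer than
      \<open>j\<close>.\<close>
    let ?S = "(E - F - {e})\<^sup>* `` A"
    have "?S \<subseteq> V"
    proof
      fix v assume "v \<in> ?S"
      then obtain a where "(a, v) \<in> (E - F - {e})\<^sup>*" "a \<in> A" by blast
      then show "v \<in> V" using assms(2) "0.prems"(1)
        by (cases rule: rtranclE) auto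
    qed
    then have "j \<le> card (out_edges E ?S)" using F(3) by (intro "0.prems"(3)) auto
    also have "out_edges E ?S \<subseteq> insert e F"
      by (auto simp: out_edges_def intro: rtrancl.rtrancl_into_rtrancl)
    then have "card (out_edges E ?S) \<le> card (insert e F)" using F(1) by (intro card_mono) auto
    also have "\<dots> \<le> k + 1" using F(1,2) by (simp add: card_insert_if)
    finally show False using 0(1) by linarith
  qed
  then show ?case by simp
next
  case (Suc d)
  have fE: "finite E" using assms(1,2) by (intro finite_subset[OF assms(2)]) simp
  have j: "j \<le> k + 1" "d = k + 2 - Suc j" using Suc(2) by auto
  let ?cut = "\<lambda>S. A \<subseteq> S \<and> S \<subseteq> V \<and> w \<notin> S \<and> card (out_edges E S) = j"
  \<comment> \<open>One factor \<open>k + 1\<close> is spent for each unit by which the minimum cut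
    is raised.\<close>
  have pow: "(k + 1) ^ (k + 2 - j) = (k + 1) * (k + 1) ^ (k + 2 - Suc j)"
    by (simp add: Suc(2)[symmetric] j(2)[symmetric] del: add_2_eq_Suc' add_2_eq_Suc)
  show ?case
  proof (cases "\<exists>S. ?cut S")
    case False
    \<comment> \<open>No cut has exactly \<open>j\<close> edges, so \<open>Suc j\<close> is a lower
      bound already for the same sources.\<close>
    then have "Suc j \<le> card (out_edges E S)" if "A \<subseteq> S" "S \<subseteq> V" "w \<notin> S" for S
      using Suc.prems(3)[OF that] that False by (metis Suc_leI le_neq_implies_less)
    then have "card (critical_into k E A w) \<le> (k + 1) ^ (k + 2 - Suc j)"
      by (intro Suc.hyps(1)[OF j(2)] Suc.prems(1,2))
    then show ?thesis unfolding pow by (simp add: trans_le_add1)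
  next
    case True
    define S where "S = (ARG_MAX card S. ?cut S)"
    have S: "?cut S" and max: "\<And>T. ?cut T \<Longrightarrow> card T \<le> card S"
    proof -
      have bd: "\<forall>S. ?cut S \<longrightarrow> card S < Suc (card V)"
        using assms(1) by (auto simp: less_Suc_eq_le card_mono)
      obtain S0 where "?cut S0" using True by blast
      from arg_max_nat_lemma[of ?cut, OF this, of card] bd
      show "?cut S" "\<And>T. ?cut T \<Longrightarrow> card T \<le> card S" unfolding S_def by blast+
    qed
    have fo: "finite (out_edges E S)" using fE by (rule finite_subset[rotated]) (auto simp: out_edges_def)
    \<comment> \<open>Uncrossing: if such a \<open>T\<close> had at most \<open>j\<close> outgoing
      edges, submodularity would make \<open>S \<union> T\<close> a cut with exactly
      \<open>j\<close> edges. It contains \<open>b\<close> and is therefore larger than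
      \<open>S\<close>.\<close>
    have big: "Suc j \<le> card (out_edges E T)"
      if T: "insert b A \<subseteq> T" "T \<subseteq> V" "w \<notin> T" and b: "b \<notin> S" for b T
    proof (rule ccontr)
      assume "\<not> Suc j \<le> card (out_edges E T)"
      moreover have "j \<le> card (out_edges E (S \<inter> T))" using S T by (intro Suc.prems(3)) auto
      moreover have "j \<le> card (out_edges E (S \<union> T))" using S T by (intro Suc.prems(3)) auto
      ultimately have "card (out_edges E (S \<union> T)) = j"
        using out_edges_submodular[OF fE, of S T] S by linarith
      then have "card (S \<union> T) \<le> card S" using S T by (intro max) auto
      moreover have "card S < card (S \<union> T)"
      proof (rule psubset_card_mono)
        show "finite (S \<union> T)" using S T(2) by (intro finite_subset[OF _ assms(1)]) simp
        show "S \<subset> S \<union> T" using T(1) b by blast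
      qed
      ultimately show False by simp
    qed
    \<comment> \<open>\<open>X\<close> collects the candidates for \<open>e\<close> when the path
      leaves \<open>S\<close> through \<open>(a, b)\<close>. If that edge already ends in
      \<open>w\<close>, it must be \<open>e\<close> itself.\<close>
    define X where "X = (\<lambda>(a, b). if b = w then {(a, b)} else critical_into k E (insert b A) w)"
    have X: "card (X c) \<le> (k + 1) ^ (k + 2 - Suc j)" if "c \<in> out_edges E S" for c
    proof -
      obtain a b where c: "c = (a, b)" by force
      then have b: "b \<in> V" "b \<notin> S" using that assms(2) by (auto simp: out_edges_def)
      show ?thesis
      proof (cases "b = w")
        case False
        then have "card (critical_into k E (insert b A) w) \<le> (k + 1) ^ (k + 2 - Suc j)"
          using b Suc.prems big by (intro Suc.hyps(1)[OF j(2)]) auto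
        then show ?thesis using False c by (simp add: X_def)
      qed (simp add: X_def c)
    qed
    have "critical_into k E A w \<subseteq> (\<Union>c \<in> out_edges E S. X c)"
    proof
      fix e assume e: "e \<in> critical_into k E A w"
      then obtain F where F: "finite F" "card F \<le> k" "w \<in> (E - F)\<^sup>* `` A" "w \<notin> (E - F - {e})\<^sup>* `` A"
        and eE: "e \<in> E" "snd e = w"
        unfolding critical_into_def by blast
      obtain x where x: "x \<in> A" "(x, w) \<in> (E - F)\<^sup>*" using F(3) by blast
      obtain a b where ab: "(x, a) \<in> ((E - F) \<inter> S \<times> S)\<^sup>*" "(a, b) \<in> E - F" "a \<in> S" "b \<notin> S" "(b, w) \<in> (E - F)\<^sup>*"
        using rtrancl_exit[OF x(2), of S] S x(1) by blast
      \<comment> \<open>The head of \<open>e\<close> is \<open>w\<close>, which lies outside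
        \<open>S\<close>, so the part of the path inside \<open>S\<close> avoids
        \<open>e\<close>.\<close>
      have "(E - F) \<inter> S \<times> S \<subseteq> E - F - {e}" using S eE(2) by auto
      then have xa: "(x, a) \<in> (E - F - {e})\<^sup>*" using ab(1) rtrancl_mono by blast
      have abo: "(a, b) \<in> out_edges E S" using ab by (auto simp: out_edges_def)
      have xb: "(x, b) \<in> (E - F - {e})\<^sup>*" if "(a, b) \<noteq> e"
        using xa ab(2) that by (auto intro: rtrancl.rtrancl_into_rtrancl)
      have "e \<in> X (a, b)"
      proof (cases "b = w")
        case True
        then have "(a, b) = e" using xb F(4) x(1) by blast
        then show ?thesis using True by (auto simp: X_def)
      next
        case False
        then have "(x, b) \<in> (E - F - {e})\<^sup>*" using xb eE(2) by (metis snd_conv)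
        then have "(b, w) \<notin> (E - F - {e})\<^sup>*" using F(4) x(1) rtrancl_trans[of x b _ w] by blast
        then have "w \<notin> (E - F - {e})\<^sup>* `` insert b A" using F(4) by blast
        moreover have "w \<in> (E - F)\<^sup>* `` insert b A" using ab(5) by blast
        ultimately have "e \<in> critical_into k E (insert b A) w"
          unfolding critical_into_def using eE F(1,2) by blast
        then show ?thesis using False by (simp add: X_def)
      qed
      then show "e \<in> (\<Union>c \<in> out_edges E S. X c)" using abo by blast
    qed
    moreover have "finite (\<Union>c \<in> out_edges E S. X c)"
    proof (intro finite_UN_I fo)
      fix c assume "c \<in> out_edges E S"
      then have "X c \<subseteq> E" by (auto simp: X_def out_edges_def critical_into_def split: if_splits)
      then show "finite (X c)" using fE by (rule finite_subset)
    qed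
    ultimately have "card (critical_into k E A w) \<le> card (\<Union>c \<in> out_edges E S. X c)"
      by (intro card_mono)
    also have "\<dots> \<le> (\<Sum>c \<in> out_edges E S. card (X c))" by (rule card_UN_le[OF fo])
    also have "\<dots> \<le> card (out_edges E S) * (k + 1) ^ (k + 2 - Suc j)"
      using X sum_bounded_above[of "out_edges E S" "\<lambda>c. card (X c)" "(k + 1) ^ (k + 2 - Suc j)"] by simp
    also have "\<dots> \<le> (k + 1) * (k + 1) ^ (k + 2 - Suc j)" using S j by (intro mult_le_mono1) simp
    finally show ?thesis unfolding pow .
  qed
qed

text \<open>Sort the edges by head. Each is critical for its own head \<open>w\<close>, and
  \<open>card_critical_into\<close> with the single source \<open>s\<close> and the trivial cut
  bound \<open>0\<close> allows \<open>(k + 1) ^ (k + 2)\<close> edges at each \<open>w\<close>.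
  Later \<open>W\<close> is either the set of all vertices or the set of hubs of one edge.\<close>

lemma card_critical_heads:
  assumes "finite V" "E \<subseteq> V \<times> V" "s \<in> V" "finite W"
    and "\<And>e. e \<in> J \<Longrightarrow> snd e \<in> W \<and> (\<exists>t. e \<in> critical k E s t)"
  shows "card J \<le> (k + 1) ^ (k + 2) * card W"
proof -
  have fE: "finite E" using assms(1,2) by (intro finite_subset[OF assms(2)]) simp
  let ?C = "\<lambda>w. critical_into k E {s} w"
  have "J \<subseteq> (\<Union>w \<in> W. ?C w)"
  proof
    fix e assume e: "e \<in> J"
    obtain u w where uw: "e = (u, w)" by force
    obtain t where "(u, w) \<in> critical k E s t" using assms(5)[OF e] uw by blast
    then have c: "(u, w) \<in> critical k E s w" by (rule critical_head)
    then obtain F where "finite F" "card F \<le> k" "(s, w) \<in> (E - F)\<^sup>*" "(s, w) \<notin> (E - F - {(u, w)})\<^sup>*"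
      unfolding critical_def by blast
    moreover have "(u, w) \<in> E" using c by (rule subsetD[OF critical_subset])
    ultimately have "e \<in> ?C w" unfolding critical_into_def uw by auto
    then show "e \<in> (\<Union>w \<in> W. ?C w)" using assms(5)[OF e] uw by auto
  qed
  moreover have "finite (?C w)" for w using fE by (rule finite_subset[rotated]) (auto simp: critical_into_def)
  ultimately have "card J \<le> card (\<Union>w \<in> W. ?C w)" using assms(4) by (intro card_mono) auto
  also have "\<dots> \<le> (\<Sum>w \<in> W. card (?C w))" by (rule card_UN_le[OF assms(4)])
  also have "\<dots> \<le> of_nat (card W) * (k + 1) ^ (k + 2)"
  proof (rule sum_bounded_above)
    fix w
    show "card (?C w) \<le> (k + 1) ^ (k + 2)"
    proof (cases "w = s")
      case True
      then have "?C w = {}" by (auto simp: critical_into_def)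
      then show ?thesis by simp
    next
      case False
      then show ?thesis using card_critical_into[OF assms(1,2), of "{s}" w 0 k] assms(3) by simp
    qed
  qed
  finally show ?thesis by (simp add: mult.commute)
qed

text \<open>
  Let \<open>X\<close> be reachable from \<open>s\<close>, and let \<open>t\<close> be reachable from \<open>Y\<close>, both avoiding \<open>a, b, c\<close>. Any two of
  \<open>a, b, c\<close> include an edge leaving \<open>X\<close> and one entering \<open>Y\<close>, so one edge does both.
\<close>

lemma no_three_pairwise_cuts:
  assumes reach: "(s, t) \<in> (E - {a})\<^sup>*" "(s, t) \<in> (E - {b})\<^sup>*" "(s, t) \<in> (E - {c})\<^sup>*"
    and cut: "(s, t) \<notin> (E - {a, b})\<^sup>*" "(s, t) \<notin> (E - {a, c})\<^sup>*" "(s, t) \<notin> (E - {b, c})\<^sup>*"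
  shows False
proof -
  let ?R = "E - {a, b, c}"
  let ?X = "{v. (s, v) \<in> ?R\<^sup>*}" and ?Y = "{v. (v, t) \<in> ?R\<^sup>*}"
  have nt: "(s, t) \<notin> ?R\<^sup>*" using cut(1) rtrancl_mono[of ?R "E - {a, b}"] by blast
  have leave: "\<exists>e \<in> E. e \<noteq> g \<and> e \<in> {a, b, c} \<and> fst e \<in> ?X" if g: "(s, t) \<in> (E - {g})\<^sup>*" for g
  proof -
    obtain u v where uv: "(u, v) \<in> E - {g}" "u \<in> ?X" "v \<notin> ?X"
      using rtrancl_exit[OF g, of ?X] nt by auto
    then have "(u, v) \<in> {a, b, c}" by (auto intro: rtrancl.rtrancl_into_rtrancl)
    then show ?thesis using uv by force
  qed
  have enter: "\<exists>e \<in> E. e \<noteq> g \<and> e \<in> {a, b, c} \<and> snd e \<in> ?Y" if g: "(s, t) \<in> (E - {g})\<^sup>*" for g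
  proof -
    obtain u v where uv: "(u, v) \<in> E - {g}" "u \<notin> ?Y" "v \<in> ?Y"
      using rtrancl_exit[OF g, of "- ?Y"] nt by auto
    then have "(u, v) \<in> {a, b, c}" by (auto intro: converse_rtrancl_into_rtrancl)
    then show ?thesis using uv by force
  qed
  \<comment> \<open>Restoring one edge from \<open>?X\<close> to \<open>?Y\<close> reconnects
    \<open>s\<close> with \<open>t\<close>. Hence none of the three edges does both, since the other
    two form a cut.\<close>
  have both: "(s, t) \<in> (insert e ?R)\<^sup>*" if "fst e \<in> ?X" "snd e \<in> ?Y" for e
  proof -
    have "(s, fst e) \<in> (insert e ?R)\<^sup>*" "(snd e, t) \<in> (insert e ?R)\<^sup>*"
      using that rtrancl_mono[of ?R "insert e ?R"] by auto
    moreover have "(fst e, snd e) \<in> (insert e ?R)\<^sup>*" by auto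
    ultimately show ?thesis by (meson rtrancl_trans)
  qed
  have ne: "a \<noteq> b" "a \<noteq> c" "b \<noteq> c" using reach cut by auto
  define X where "X g \<longleftrightarrow> g \<in> E \<and> fst g \<in> ?X" for g
  define Y where "Y g \<longleftrightarrow> g \<in> E \<and> snd g \<in> ?Y" for g
  have "\<not> (X a \<and> Y a)" using both[of a] cut(3) ne rtrancl_mono[of "insert a ?R" "E - {b, c}"] unfolding X_def Y_def by auto
  moreover have "\<not> (X b \<and> Y b)" using both[of b] cut(2) ne rtrancl_mono[of "insert b ?R" "E - {a, c}"] unfolding X_def Y_def by auto
  moreover have "\<not> (X c \<and> Y c)" using both[of c] cut(1) ne rtrancl_mono[of "insert c ?R" "E - {a, b}"] unfolding X_def Y_def by auto
  moreover have "X b \<or> X c" "X a \<or> X c" "X a \<or> X b"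
    using leave[OF reach(1)] leave[OF reach(2)] leave[OF reach(3)] unfolding X_def by blast+
  moreover have "Y b \<or> Y c" "Y a \<or> Y c" "Y a \<or> Y b"
    using enter[OF reach(1)] enter[OF reach(2)] enter[OF reach(3)] unfolding Y_def by blast+
  ultimately show False by blast
qed


section \<open>Counting the edges of a minimal preserver\<close>

text \<open>
  If the faults of two edges of \<open>J\<close> together do not form a cut, then a path avoiding them passes through both
  edges; and no three of the faults can pairwise form cuts.
\<close>

lemma card_two_cut_edges:
  fixes F :: "'a \<times> 'a \<Rightarrow> ('a \<times> 'a) set"
  assumes "finite J"
    and F: "\<And>e. e \<in> J \<Longrightarrow> finite (F e) \<and> card (F e) \<le> 1 \<and> (s, t) \<in> (E - F e)\<^sup>* \<and> (s, t) \<notin> (E - F e - {e})\<^sup>*"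
    and M: "\<And>e. e \<in> J \<Longrightarrow> card {e' \<in> J. (s, snd e') \<in> (E - F e)\<^sup>* \<and> (snd e', t) \<in> (E - F e)\<^sup>*} \<le> M"
  shows "card J \<le> 2 * M"
proof -
  let ?N = "\<lambda>e. {e' \<in> J. (s, snd e') \<in> (E - F e)\<^sup>* \<and> (snd e', t) \<in> (E - F e)\<^sup>*}"
  have near: "e' \<in> ?N e" if e: "e \<in> J" "e' \<in> J" and r: "(s, t) \<in> (E - (F e \<union> F e'))\<^sup>*" for e e'
  proof -
    obtain u w where uw: "e' = (u, w)" by force
    have "(E - (F e \<union> F e') - {e'})\<^sup>* \<subseteq> (E - F e' - {e'})\<^sup>*" by (rule rtrancl_mono) auto
    then have "(s, t) \<notin> (E - (F e \<union> F e') - {(u, w)})\<^sup>*" using F[OF e(2)] uw by auto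
    from bridge_split(4,5)[OF r this]
    have "(s, w) \<in> (E - (F e \<union> F e'))\<^sup>*" "(w, t) \<in> (E - (F e \<union> F e'))\<^sup>*" .
    moreover have "(E - (F e \<union> F e'))\<^sup>* \<subseteq> (E - F e)\<^sup>*" by (rule rtrancl_mono) auto
    ultimately show ?thesis using e uw by auto
  qed
  have single: "\<exists>g. F e = {g}" if "e \<in> J" "e' \<in> J" and "(s, t) \<notin> (E - (F e \<union> F e'))\<^sup>*" for e e'
  proof -
    \<comment> \<open>If \<open>F e\<close> were empty, the union would be \<open>F e'\<close>,
      which does not separate \<open>s\<close> from \<open>t\<close>.\<close>
    have "F e \<noteq> {}" using that(3) F[OF that(2)] by auto
    then have "card (F e) = 1" using F[OF that(1)] by (metis card_0_eq le_neq_implies_less less_one)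
    then show ?thesis by (rule card_1_singletonE) blast
  qed
  show ?thesis
  proof (cases "\<exists>e1 \<in> J. \<exists>e2 \<in> J. (s, t) \<notin> (E - (F e1 \<union> F e2))\<^sup>*")
    case False
    show ?thesis
    proof (cases "J = {}")
      case J: False
      then obtain e where e: "e \<in> J" by blast
      then have "J \<subseteq> ?N e" using near False by blast
      then have "card J \<le> card (?N e)" using assms(1) by (intro card_mono) auto
      then show ?thesis using M[OF e] by linarith
    qed simp
  next
    case True
    then obtain e1 e2 where e12: "e1 \<in> J" "e2 \<in> J" "(s, t) \<notin> (E - (F e1 \<union> F e2))\<^sup>*" by blast
    \<comment> \<open>An edge outside both sets would have faults forming a cut with those of
      \<open>e1\<close> and with those of \<open>e2\<close>, hence three pairwise cuts. So two sets
      of size at most \<open>M\<close> cover \<open>J\<close>.\<close>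
    have "J \<subseteq> ?N e1 \<union> ?N e2"
    proof
      fix e assume e: "e \<in> J"
      show "e \<in> ?N e1 \<union> ?N e2"
      proof (rule ccontr)
        assume "e \<notin> ?N e1 \<union> ?N e2"
        then have cut: "(s, t) \<notin> (E - (F e1 \<union> F e))\<^sup>*" "(s, t) \<notin> (E - (F e2 \<union> F e))\<^sup>*"
          using near[OF e12(1) e] near[OF e12(2) e] by blast+
        have cut': "(s, t) \<notin> (E - (F e \<union> F e1))\<^sup>*" "(s, t) \<notin> (E - (F e2 \<union> F e1))\<^sup>*"
          using cut(1) e12(3) by (simp_all add: Un_commute)
        obtain a b c where abc: "F e1 = {a}" "F e2 = {b}" "F e = {c}"
          using single[OF e12] single[OF e12(2,1) cut'(2)] single[OF e e12(1) cut'(1)] by blast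
        show False
        proof (rule no_three_pairwise_cuts)
          show "(s, t) \<in> (E - {a})\<^sup>*" "(s, t) \<in> (E - {b})\<^sup>*" "(s, t) \<in> (E - {c})\<^sup>*"
            using F[OF e12(1)] F[OF e12(2)] F[OF e] abc by auto
          show "(s, t) \<notin> (E - {a, b})\<^sup>*" "(s, t) \<notin> (E - {a, c})\<^sup>*" "(s, t) \<notin> (E - {b, c})\<^sup>*"
            using e12(3) cut abc by (simp_all add: insert_commute)
        qed
      qed
    qed
    then have "card J \<le> card (?N e1 \<union> ?N e2)" using assms(1) by (intro card_mono) auto
    also have "\<dots> \<le> card (?N e1) + card (?N e2)" by (rule card_Un_le)
    finally show ?thesis using M[OF e12(1)] M[OF e12(2)] by linarith
  qed
qed

section \<open>Edges with few hubs and edges with many hubs\<close>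

lemma rtrancl_in_carrier: "(s, r) \<in> E\<^sup>* \<Longrightarrow> s \<in> V \<Longrightarrow> E \<subseteq> V \<times> V \<Longrightarrow> r \<in> V"
  by (induction rule: rtrancl_induct) auto

text \<open>In an inclusion-minimal connecting set every edge is a bridge. Then no two edges share a
  head, and every head lies between \<open>s\<close> and \<open>t\<close>. In effect
  \<open>Q\<close> is a path whose length is bounded by the number of hubs.\<close>

lemma sparse_connecting_subgraph:
  assumes "finite V" "E \<subseteq> V \<times> V" "s \<in> V" "(s, t) \<in> E\<^sup>*"
  obtains Q where "Q \<subseteq> E" "(s, t) \<in> Q\<^sup>*" "card Q \<le> card {r. (s, r) \<in> E\<^sup>* \<and> (r, t) \<in> E\<^sup>*}"
proof -
  have fE: "finite E" using assms(1) by (intro finite_subset[OF assms(2)]) simp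
  let ?W = "{r. (s, r) \<in> E\<^sup>* \<and> (r, t) \<in> E\<^sup>*}"
  define A where "A = {Q. Q \<subseteq> E \<and> (s, t) \<in> Q\<^sup>*}"
  have "finite A" unfolding A_def using fE by simp
  moreover have "A \<noteq> {}" using assms(4) unfolding A_def by blast
  ultimately obtain Q where QA: "Q \<in> A" and min: "\<And>Q'. Q' \<in> A \<Longrightarrow> Q' \<subseteq> Q \<Longrightarrow> Q = Q'"
    using finite_has_minimal[of A] by blast
  have Q: "Q \<subseteq> E" "(s, t) \<in> Q\<^sup>*" using QA unfolding A_def by auto
  have br: "(s, t) \<notin> (Q - {e})\<^sup>*" if e: "e \<in> Q" for e
  proof
    assume "(s, t) \<in> (Q - {e})\<^sup>*"
    then have "Q - {e} \<in> A" using Q(1) unfolding A_def by blast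
    then show False using min[of "Q - {e}"] e by blast
  qed
  have mono: "Q\<^sup>* \<subseteq> E\<^sup>*" using Q(1) by (rule rtrancl_mono)
  have inj: "inj_on snd Q"
  proof (rule inj_onI)
    fix e e' assume e: "e \<in> Q" "e' \<in> Q" "snd e = snd e'"
    show "e = e'"
    proof (rule ccontr)
      assume ne: "e \<noteq> e'"
      obtain u u' w where uw: "e = (u, w)" "e' = (u', w)" using e(3) by (metis prod.collapse)
      have b: "(s, t) \<notin> (Q - {(u, w)})\<^sup>*" "(s, t) \<notin> (Q - {(u', w)})\<^sup>*" using br e uw by auto
      have u: "(s, u) \<in> (Q - {(u, w)})\<^sup>*" and nw: "(s, w) \<notin> (Q - {(u, w)})\<^sup>*"
        and nw': "(s, w) \<notin> (Q - {(u', w)})\<^sup>*"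
        using bridge_split(1,3)[OF Q(2) b(1)] bridge_split(3)[OF Q(2) b(2)] .
      \<comment> \<open>A path to \<open>u\<close> avoiding \<open>(u', w)\<close> could be
        continued by \<open>(u, w)\<close>, against the second bridge. So the path to
        \<open>u\<close> that avoids \<open>(u, w)\<close> goes through \<open>(u', w)\<close> and
        visits \<open>w\<close> on its way, against the first bridge.\<close>
      have "(u, w) \<in> Q - {(u', w)}" using e uw ne by auto
      then have "(s, u) \<notin> (Q - {(u', w)})\<^sup>*"
        using nw' by (meson rtrancl.rtrancl_into_rtrancl)
      moreover have "(Q - {(u, w)} - {(u', w)})\<^sup>* \<subseteq> (Q - {(u', w)})\<^sup>*" by (rule rtrancl_mono) auto
      ultimately have "(s, u) \<notin> (Q - {(u, w)} - {(u', w)})\<^sup>*" by auto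
      then show False using bridge_split(4)[OF u] nw by simp
    qed
  qed
  have sub: "snd ` Q \<subseteq> ?W"
  proof
    fix w assume "w \<in> snd ` Q"
    then obtain u where "(u, w) \<in> Q" by force
    then have "(s, w) \<in> Q\<^sup>*" "(w, t) \<in> Q\<^sup>*" using bridge_split(4,5)[OF Q(2) br] by auto
    then show "w \<in> ?W" using mono by auto
  qed
  have "?W \<subseteq> V" using rtrancl_in_carrier[OF _ assms(3,2)] by auto
  then have "finite ?W" using assms(1) by (rule finite_subset)
  then have "card Q \<le> card ?W" using card_inj_on_le[OF inj sub] by simp
  then show ?thesis using that Q by simp
qed

text \<open>Fix a connecting set \<open>Q\<close> of at most \<open>x\<close> edges that avoids the
  faults of one edge \<open>e0\<close>. Every cut \<open>F e \<union> {e}\<close> meets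
  \<open>Q\<close>: either \<open>e\<close> lies in \<open>Q\<close>, which gives the summand
  \<open>x\<close>, or some \<open>f\<close> in \<open>Q\<close> is a fault of \<open>e\<close>, and
  \<open>card_two_cut_edges\<close> applies once \<open>f\<close> is deleted.\<close>

lemma card_short_critical_edges:
  fixes F :: "'a \<times> 'a \<Rightarrow> ('a \<times> 'a) set"
  assumes V: "finite V" "E \<subseteq> V \<times> V" "s \<in> V"
    and F: "\<And>e. e \<in> J \<Longrightarrow> finite (F e) \<and> card (F e) \<le> 2 \<and> (s, t) \<in> (E - F e)\<^sup>* \<and> (s, t) \<notin> (E - F e - {e})\<^sup>*"
    and short: "\<And>e. e \<in> J \<Longrightarrow> card {r. (s, r) \<in> (E - F e)\<^sup>* \<and> (r, t) \<in> (E - F e)\<^sup>*} \<le> x"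
  shows "card J \<le> x + x * (162 * x)"
proof (cases "J = {}")
  case False
  have fE: "finite E" using V(1) by (intro finite_subset[OF V(2)]) simp
  let ?W = "\<lambda>e. {r. (s, r) \<in> (E - F e)\<^sup>* \<and> (r, t) \<in> (E - F e)\<^sup>*}"
  have finW: "finite (?W e)" for e
  proof (rule finite_subset[OF _ V(1)])
    have "E - F e \<subseteq> V \<times> V" using V(2) by auto
    then show "?W e \<subseteq> V" using rtrancl_in_carrier[OF _ V(3), of _ "E - F e"] by auto
  qed
  have crit: "e \<in> critical 2 E s t" if "e \<in> J" for e
    using F[OF that] by (auto intro: criticalI[of "F e"])
  have JE: "J \<subseteq> E" using crit critical_subset[of 2 E s t] by auto
  then have fJ: "finite J" using fE by (rule finite_subset)
  obtain e0 where e0: "e0 \<in> J" using False by auto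
  have sub0: "E - F e0 \<subseteq> V \<times> V" using V(2) by auto
  have "(s, t) \<in> (E - F e0)\<^sup>*" using F[OF e0] by simp
  then obtain Q where Q: "Q \<subseteq> E - F e0" "(s, t) \<in> Q\<^sup>*" "card Q \<le> card (?W e0)"
    by (rule sparse_connecting_subgraph[OF V(1) sub0 V(3)])
  have cQ: "card Q \<le> x" using Q(3) short[OF e0] by simp
  have fQ: "finite Q" using Q(1) fE by (intro finite_subset[OF Q(1)]) simp
  define K where "K f = {e \<in> J. f \<in> F e}" for f
  have K: "card (K f) \<le> 162 * x" for f
  proof -
    \<comment> \<open>With \<open>f\<close> deleted from the graph, every edge in \<open>K f\<close>
      keeps at most one further fault.\<close>
    have "card (K f) \<le> 2 * (81 * x)"
    proof (rule card_two_cut_edges[where E = "E - {f}" and F = "\<lambda>e. F e - {f}" and s = s and t = t])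
      show "finite (K f)" using fJ by (simp add: K_def)
      fix e assume "e \<in> K f"
      then have e: "e \<in> J" "f \<in> F e" by (simp_all add: K_def)
      have eq: "E - {f} - (F e - {f}) = E - F e" using e(2) by auto
      have "card (F e) \<le> 2" using F[OF e(1)] by simp
      then have "card (F e - {f}) \<le> 1" using e(2) by (simp add: card_Diff_singleton)
      then show "finite (F e - {f}) \<and> card (F e - {f}) \<le> 1 \<and>
          (s, t) \<in> (E - {f} - (F e - {f}))\<^sup>* \<and> (s, t) \<notin> (E - {f} - (F e - {f}) - {e})\<^sup>*"
        unfolding eq using F[OF e(1)] by simp
      let ?N = "{e' \<in> K f. (s, snd e') \<in> (E - F e)\<^sup>* \<and> (snd e', t) \<in> (E - F e)\<^sup>*}"
      \<comment> \<open>All of \<open>?N\<close> is critical in the full edge set \<open>E\<close>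
        with source \<open>s\<close>, and its heads are hubs of \<open>e\<close>. This allows
        \<open>3 ^ 4 = 81\<close> edges at each of at most \<open>x\<close> heads.\<close>
      have "card ?N \<le> (2 + 1) ^ (2 + 2) * card (?W e)"
      proof (rule card_critical_heads[OF V finW])
        fix e' assume "e' \<in> ?N"
        then show "snd e' \<in> ?W e \<and> (\<exists>t. e' \<in> critical 2 E s t)" using crit[of e'] by (auto simp: K_def)
      qed
      also have "\<dots> \<le> 81 * x" using short[OF e(1)] by simp
      finally show "card {e' \<in> K f. (s, snd e') \<in> (E - {f} - (F e - {f}))\<^sup>* \<and>
          (snd e', t) \<in> (E - {f} - (F e - {f}))\<^sup>*} \<le> 81 * x"
        unfolding eq .
    qed
    then show ?thesis by simp
  qed
  have "J \<subseteq> Q \<union> (\<Union>f \<in> Q. K f)"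
  proof
    fix e assume e: "e \<in> J"
    show "e \<in> Q \<union> (\<Union>f \<in> Q. K f)"
    proof (rule ccontr)
      assume "e \<notin> Q \<union> (\<Union>f \<in> Q. K f)"
      \<comment> \<open>\<open>Q\<close> would survive the removal of \<open>F e\<close> and
        \<open>e\<close> and still connect \<open>s\<close> to \<open>t\<close>.\<close>
      then have "Q \<subseteq> E - F e - {e}" using Q(1) e by (auto simp: K_def)
      then show False using rtrancl_mono[of Q "E - F e - {e}"] Q(2) F[OF e] by auto
    qed
  qed
  then have "card J \<le> card (Q \<union> (\<Union>f \<in> Q. K f))"
    using fQ fJ by (intro card_mono) (auto simp: K_def)
  also have "\<dots> \<le> card Q + card (\<Union>f \<in> Q. K f)" by (rule card_Un_le)
  also have "card (\<Union>f \<in> Q. K f) \<le> (\<Sum>f \<in> Q. card (K f))" by (rule card_UN_le[OF fQ])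
  also have "\<dots> \<le> card Q * (162 * x)" using sum_bounded_above[of Q "\<lambda>f. card (K f)" "162 * x"] K by simp
  also have "card Q + card Q * (162 * x) \<le> x + x * (162 * x)" using cQ by (intro add_mono mult_mono) auto
  finally show ?thesis by simp
qed simp

text \<open>Edges critical with source \<open>r\<close> are counted by
  \<open>card_critical_heads\<close> with all vertices as heads. Those with target \<open>r\<close>
  have source \<open>r\<close> in the reversed graph, which accounts for the factor 2.\<close>

lemma card_hub_edges:
  assumes V: "finite V" "E \<subseteq> V \<times> V" "r \<in> V"
    and J: "\<And>e. e \<in> J \<Longrightarrow> \<exists>v. e \<in> critical k E r v \<or> e \<in> critical k E v r"
  shows "card J \<le> 2 * (k + 1) ^ (k + 2) * card V"
proof -
  let ?A = "{e. \<exists>v. e \<in> critical k E r v}" and ?B = "{e. \<exists>v. e \<in> critical k E v r}"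
  have fE: "finite E" using V(1) by (intro finite_subset[OF V(2)]) simp
  have AE: "?A \<subseteq> E" and BE: "?B \<subseteq> E" using critical_subset by fastforce+
  have A: "card ?A \<le> (k + 1) ^ (k + 2) * card V"
  proof (rule card_critical_heads[OF V V(1)])
    fix e assume "e \<in> ?A"
    then show "snd e \<in> V \<and> (\<exists>t. e \<in> critical k E r t)" using subsetD[OF AE, of e] V(2) by auto
  qed
  have "card (?B\<inverse>) \<le> (k + 1) ^ (k + 2) * card V"
  proof (rule card_critical_heads[OF V(1) _ V(3) V(1)])
    show "E\<inverse> \<subseteq> V \<times> V" using V(2) by auto
    fix e assume e: "e \<in> ?B\<inverse>"
    obtain w u where wu: "e = (w, u)" by force
    then obtain v where v: "(u, w) \<in> critical k E v r" using e by auto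
    then have "e \<in> critical k (E\<inverse>) r v" unfolding wu by (subst (asm) critical_converse)
    moreover have "(u, w) \<in> E" using v by (rule subsetD[OF critical_subset])
    ultimately show "snd e \<in> V \<and> (\<exists>t. e \<in> critical k (E\<inverse>) r t)" using V(2) wu by auto
  qed
  then have B: "card ?B \<le> (k + 1) ^ (k + 2) * card V" by simp
  have "J \<subseteq> ?A \<union> ?B" using J by blast
  moreover have "finite (?A \<union> ?B)" using AE BE fE by (simp add: finite_subset)
  ultimately have "card J \<le> card (?A \<union> ?B)" by (intro card_mono)
  also have "\<dots> \<le> card ?A + card ?B" by (rule card_Un_le)
  also have "\<dots> \<le> (k + 1) ^ (k + 2) * card V + (k + 1) ^ (k + 2) * card V" using A B by (rule add_mono)
  also have "\<dots> = 2 * (k + 1) ^ (k + 2) * card V" by (simp only: mult_2 add_mult_distrib)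
  finally show ?thesis .
qed

text \<open>\<open>l\<close> is the number of edges with more than \<open>x\<close> hubs, bounded by
  counting the incidences of such edges with their hubs in two ways. Every other edge is charged to
  the pair chosen for it, and \<open>card_short_critical_edges\<close> bounds the charge of each
  pair.\<close>

lemma card_all_critical:
  assumes V: "finite V" "E \<subseteq> V \<times> V" and P: "P \<subseteq> V \<times> V"
    and crit: "\<And>e. e \<in> E \<Longrightarrow> \<exists>(s, t) \<in> P. e \<in> critical 2 E s t"
  shows "\<exists>l. card E \<le> l + card P * (x + x * (162 * x)) \<and> x * l \<le> 162 * (card V)\<^sup>2"
proof -
  have fE: "finite E" using V(1) by (intro finite_subset[OF V(2)]) simp
  have fP: "finite P" using V(1) by (intro finite_subset[OF P]) simp
  have "\<forall>e \<in> E. \<exists>q F. q \<in> P \<and> finite F \<and> card F \<le> 2 \<and>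
      (fst q, snd q) \<in> (E - F)\<^sup>* \<and> (fst q, snd q) \<notin> (E - F - {e})\<^sup>*"
  proof
    fix e assume "e \<in> E"
    then obtain s t where "(s, t) \<in> P" "e \<in> critical 2 E s t" using crit by fast
    then show "\<exists>q F. q \<in> P \<and> finite F \<and> card F \<le> 2 \<and>
      (fst q, snd q) \<in> (E - F)\<^sup>* \<and> (fst q, snd q) \<notin> (E - F - {e})\<^sup>*"
      unfolding critical_def by (intro exI[of _ "(s, t)"]) auto
  qed
  then obtain q F where q: "\<And>e. e \<in> E \<Longrightarrow> q e \<in> P"
    and F: "\<And>e. e \<in> E \<Longrightarrow> finite (F e) \<and> card (F e) \<le> 2 \<and>
      (fst (q e), snd (q e)) \<in> (E - F e)\<^sup>* \<and> (fst (q e), snd (q e)) \<notin> (E - F e - {e})\<^sup>*"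
    by metis
  define hub where "hub e r \<longleftrightarrow> (fst (q e), r) \<in> (E - F e)\<^sup>* \<and> (r, snd (q e)) \<in> (E - F e)\<^sup>*" for e r
  have hubV: "r \<in> V" if "hub e r" "e \<in> E" for e r
  proof -
    have "fst (q e) \<in> V" using q[OF that(2)] P by auto
    moreover have "E - F e \<subseteq> V \<times> V" using V(2) by auto
    ultimately show ?thesis
      using that(1) rtrancl_in_carrier[of "fst (q e)" r "E - F e" V] unfolding hub_def by simp
  qed
  define L where "L = {e \<in> E. x < card {r \<in> V. hub e r}}"
  have fL: "finite L" using fE by (simp add: L_def)
  have "x * card L \<le> (\<Sum>e \<in> L. card {r \<in> V. hub e r})"
    using sum_bounded_below[of L x "\<lambda>e. card {r \<in> V. hub e r}"] by (simp add: L_def mult.commute)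
  also have "\<dots> = (\<Sum>r \<in> V. card {e \<in> L. hub e r})"
    by (rule sum_multicount_gen[OF fL V(1)]) simp
  also have "\<dots> \<le> of_nat (card V) * (162 * card V)"
  proof (rule sum_bounded_above)
    fix r assume r: "r \<in> V"
    have "card {e \<in> L. hub e r} \<le> 2 * (2 + 1) ^ (2 + 2) * card V"
    proof (rule card_hub_edges[OF V r])
      fix e assume "e \<in> {e \<in> L. hub e r}"
      then have e: "e \<in> E" "hub e r" by (simp_all add: L_def)
      \<comment> \<open>Without \<open>e\<close> the connection through \<open>r\<close> breaks in
        its first or its second half. The same faults therefore make \<open>e\<close> critical for
        the source and \<open>r\<close>, or for \<open>r\<close> and the target.\<close>
      have "\<not> ((fst (q e), r) \<in> (E - F e - {e})\<^sup>* \<and> (r, snd (q e)) \<in> (E - F e - {e})\<^sup>*)"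
        using F[OF e(1)] rtrancl_trans[of "fst (q e)" r "E - F e - {e}" "snd (q e)"] by blast
      then show "\<exists>v. e \<in> critical 2 E r v \<or> e \<in> critical 2 E v r"
        using e(2) F[OF e(1)] unfolding hub_def critical_def by blast
    qed
    then show "card {e \<in> L. hub e r} \<le> 162 * card V" by simp
  qed
  finally have long: "x * card L \<le> 162 * (card V)\<^sup>2" by (simp add: power2_eq_square mult_ac)
  define S where "S p = {e \<in> E - L. q e = p}" for p
  have short: "card (S p) \<le> x + x * (162 * x)" if p: "p \<in> P" for p
  proof (rule card_short_critical_edges[OF V, where s = "fst p" and t = "snd p" and F = F])
    show "fst p \<in> V" using p P by auto
    fix e assume "e \<in> S p"
    then have e: "e \<in> E" "e \<notin> L" "q e = p" by (simp_all add: S_def)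
    show "finite (F e) \<and> card (F e) \<le> 2 \<and> (fst p, snd p) \<in> (E - F e)\<^sup>* \<and> (fst p, snd p) \<notin> (E - F e - {e})\<^sup>*"
      using F[OF e(1)] e(3) by simp
    have "{r. (fst p, r) \<in> (E - F e)\<^sup>* \<and> (r, snd p) \<in> (E - F e)\<^sup>*} = {r \<in> V. hub e r}"
      using hubV[OF _ e(1)] e(3) by (auto simp: hub_def)
    then show "card {r. (fst p, r) \<in> (E - F e)\<^sup>* \<and> (r, snd p) \<in> (E - F e)\<^sup>*} \<le> x"
      using e(1,2) by (simp add: L_def not_less)
  qed
  have "E \<subseteq> L \<union> (\<Union>p \<in> P. S p)" using q by (auto simp: S_def)
  then have "card E \<le> card (L \<union> (\<Union>p \<in> P. S p))"
    using fL fP fE by (intro card_mono) (auto simp: S_def)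
  also have "\<dots> \<le> card L + card (\<Union>p \<in> P. S p)" by (rule card_Un_le)
  also have "card (\<Union>p \<in> P. S p) \<le> (\<Sum>p \<in> P. card (S p))" by (rule card_UN_le[OF fP])
  also have "\<dots> \<le> card P * (x + x * (162 * x))"
    using sum_bounded_above[of P "\<lambda>p. card (S p)" "x + x * (162 * x)"] short by simp
  finally have "card E \<le> card L + card P * (x + x * (162 * x))" by simp
  then show ?thesis using long by blast
qed

lemma card_all_critical_powr:
  assumes V: "finite V" "E \<subseteq> V \<times> V" and P: "P \<subseteq> V \<times> V"
    and crit: "\<And>e. e \<in> E \<Longrightarrow> \<exists>(s, t) \<in> P. e \<in> critical 2 E s t"
  shows "real (card E) \<le> 812 * real (card V) powr (4 / 3) * real (card P) powr (1 / 3)"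
proof (cases "P = {}")
  case True
  then have "E = {}" using crit by auto
  then show ?thesis by simp
next
  case False
  define n p where "n = real (card V)" and "p = real (card P)"
  have fP: "finite P" using V(1) by (intro finite_subset[OF P]) simp
  have p: "p \<ge> 1" using False fP by (simp add: p_def Suc_le_eq card_gt_0_iff)
  have "card P \<le> card V * card V" using card_mono[OF _ P] V(1) by (simp add: card_cartesian_product)
  then have pn: "p \<le> n\<^sup>2" by (simp add: p_def n_def power2_eq_square flip: of_nat_mult)
  have n: "n > 0" using pn p by (cases "card V") (auto simp: n_def)
  \<comment> \<open>This is \<open>(n ^ 2 / p) powr (1 / 3)\<close>, the value at which
    \<open>n ^ 2 / y\<close> and \<open>p * y ^ 2\<close> coincide.\<close>
  define y where "y = n powr (2 / 3) * p powr (- 1 / 3)"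
  have y0: "y > 0" using n p by (simp add: y_def)
  have ppy: "p * y\<^sup>2 = n powr (4 / 3) * p powr (1 / 3)"
  proof -
    have "p * y\<^sup>2 = n powr (4 / 3) * (p powr 1 * p powr (- 2 / 3))"
      using n p by (simp add: y_def power2_eq_square algebra_simps flip: powr_add)
    also have "p powr 1 * p powr (- 2 / 3) = p powr (1 / 3)" by (simp only: powr_add[symmetric]) simp
    finally show ?thesis .
  qed
  have py3: "p * y ^ 3 = n\<^sup>2"
  proof -
    have "y ^ 3 = y powr 3" using y0 by simp
    also have "\<dots> = n powr 2 * p powr (- 1)" using n p by (simp add: y_def powr_mult powr_powr)
    finally show ?thesis using n p by (simp add: powr_minus)
  qed
  \<comment> \<open>Follows from \<open>p \<le> n\<^sup>2\<close>. Rounding \<open>y\<close> up then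
    costs at most a factor 2, and the linear term is absorbed by the quadratic one.\<close>
  have y1: "y \<ge> 1"
  proof (rule ccontr)
    assume "\<not> y \<ge> 1"
    then have "y ^ 3 < 1" using y0 by (simp add: power_less_one_iff)
    then have "p * y ^ 3 < p" using p by simp
    then show False using py3 pn by simp
  qed
  define x where "x = nat \<lceil>y\<rceil>"
  have x: "y \<le> real x" "real x \<le> 2 * y" using y1 unfolding x_def by linarith+
  obtain l where l: "card E \<le> l + card P * (x + x * (162 * x))" "x * l \<le> 162 * (card V)\<^sup>2"
    using card_all_critical[OF V P crit] by blast
  have "real x * real l = real (x * l)" by simp
  also have "\<dots> \<le> real (162 * (card V)\<^sup>2)" using l(2) by (simp only: of_nat_le_iff)
  also have "\<dots> = 162 * n\<^sup>2" by (simp add: n_def)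
  finally have "real x * real l \<le> 162 * n\<^sup>2" .
  moreover have "y * real l \<le> real x * real l" using x(1) by (intro mult_right_mono) auto
  ultimately have "y * real l \<le> y * (162 * (p * y\<^sup>2))"
    using py3 by (simp add: power2_eq_square power3_eq_cube algebra_simps)
  then have l2: "real l \<le> 162 * (p * y\<^sup>2)" using y0 by simp
  \<comment> \<open>The coefficients \<open>2\<close> and \<open>162 * 4 = 648\<close> add up to
    650; the 162 from the edges with many hubs brings the total to 812.\<close>
  have "real x + real x * (162 * real x) \<le> 2 * y * y + 2 * y * (162 * (2 * y))"
    using x y1 by (intro add_mono mult_mono) (auto intro: order_trans)
  then have "p * (real x + real x * (162 * real x)) \<le> p * (650 * y\<^sup>2)"
    using p by (intro mult_left_mono) (auto simp: power2_eq_square)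
  moreover have "real (card E) \<le> real (l + card P * (x + x * (162 * x)))" using l(1) by (simp only: of_nat_le_iff)
  ultimately have "real (card E) \<le> 812 * (p * y\<^sup>2)" using l2 by (simp add: p_def)
  then show ?thesis unfolding ppy by (simp add: n_def p_def mult.assoc)
qed

section \<open>Minimal preservers as fault-tolerant reachability subgraphs\<close>

definition preserves :: "nat \<Rightarrow> ('a \<times> 'a) set \<Rightarrow> ('a \<times> 'a) set \<Rightarrow> ('a \<times> 'a) set \<Rightarrow> bool" where
  "preserves k E P X \<longleftrightarrow> (\<forall>(s, t) \<in> P. \<forall>F. F \<subseteq> E \<and> finite F \<and> card F \<le> k \<longrightarrow>
     (s, t) \<in> (E - F)\<^sup>* \<longrightarrow> (s, t) \<in> (X - F)\<^sup>*)"

text \<open>Read contrapositively, an edge that cannot be deleted now cannot be deleted after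
  further deletions either. This makes a single greedy pass sufficient.\<close>

lemma preserves_mono:
  assumes "preserves k E P X" "X \<subseteq> Y"
  shows "preserves k E P Y"
proof -
  have "(X - F)\<^sup>* \<subseteq> (Y - F)\<^sup>*" for F using assms(2) by (intro rtrancl_mono) auto
  then show ?thesis using assms(1) unfolding preserves_def by blast
qed

text \<open>Some pair and fault set witness that \<open>X - {e}\<close> fails. As \<open>X\<close>
  itself succeeds on them, \<open>e\<close> is a bridge of \<open>X - F\<close> for that pair, so
  the edge count can be carried out inside \<open>X\<close>.\<close>

lemma minimal_preserver_critical:
  assumes "preserves k E P X" "\<not> preserves k E P (X - {e})"
  shows "\<exists>(s, t) \<in> P. e \<in> critical k X s t"
proof -
  obtain s t F where st: "(s, t) \<in> P" and F: "F \<subseteq> E" "finite F" "card F \<le> k" "(s, t) \<in> (E - F)\<^sup>*"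
    and cut: "(s, t) \<notin> (X - {e} - F)\<^sup>*"
    using assms(2) unfolding preserves_def by blast
  have "(s, t) \<in> (X - F)\<^sup>*" using assms(1) st F unfolding preserves_def by blast
  moreover have "X - F - {e} = X - {e} - F" by auto
  ultimately have "e \<in> critical k X s t" using F cut by (intro criticalI[of F]) auto
  then show ?thesis using st by blast
qed

text \<open>Reachability in the digraph library is reflexive only on vertices, hence the assumption
  on \<open>s\<close>.\<close>

lemma reachable_with_proj_iff:
  assumes "parcs G \<subseteq> pverts G \<times> pverts G" "s \<in> pverts G"
  shows "s \<rightarrow>\<^sup>*\<^bsub>with_proj G\<^esub> t \<longleftrightarrow> (s, t) \<in> (parcs G)\<^sup>*"
proof
  assume "s \<rightarrow>\<^sup>*\<^bsub>with_proj G\<^esub> t"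
  then show "(s, t) \<in> (parcs G)\<^sup>*" unfolding reachable_def by (simp add: rtrancl_on_rtranclI)
next
  assume "(s, t) \<in> (parcs G)\<^sup>*"
  then have "(s, t) \<in> rtrancl_on (pverts G) (parcs G)"
    by (induction rule: rtrancl_induct) (use assms in \<open>auto intro: rtrancl_on_into_rtrancl_on\<close>)
  then show "s \<rightarrow>\<^sup>*\<^bsub>with_proj G\<^esub> t" unfolding reachable_def by simp
qed

lemma preserves_imp_ft_reach_subgraph:
  assumes G: "pair_wf_digraph G" and H: "pverts H = pverts G" "parcs H \<subseteq> parcs G"
    and P: "P \<subseteq> pverts G \<times> pverts G" and pres: "preserves k (parcs G) P (parcs H)"
  shows "ft_reach_subgraph k G P H"
proof -
  have GV: "parcs G \<subseteq> pverts G \<times> pverts G"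
    using pair_wf_digraph.in_arcsD1[OF G] pair_wf_digraph.in_arcsD2[OF G] by auto
  have "pair_wf_digraph H" using H GV by unfold_locales auto
  then have sub: "subgraph (with_proj H) (with_proj G)"
    using G H by (simp add: subgraph_def wf_digraph_wp_iff compatible_def)
  have "s \<rightarrow>\<^sup>*\<^bsub>with_proj (without_arcs G F)\<^esub> t \<longleftrightarrow> s \<rightarrow>\<^sup>*\<^bsub>with_proj (without_arcs H F)\<^esub> t"
    if "(s, t) \<in> P" "F \<subseteq> parcs G" "finite F" "card F \<le> k" for s t F
  proof -
    have sV: "s \<in> pverts G" using that(1) P by auto
    \<comment> \<open>The direction from \<open>H\<close> to \<open>G\<close> is monotonicity, as
      \<open>parcs H\<close> is contained in \<open>parcs G\<close>.\<close>
    have "(s, t) \<in> (parcs G - F)\<^sup>* \<longleftrightarrow> (s, t) \<in> (parcs H - F)\<^sup>*"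
      using pres that rtrancl_mono[of "parcs H - F" "parcs G - F"] H(2) unfolding preserves_def by blast
    moreover have "s \<rightarrow>\<^sup>*\<^bsub>with_proj (without_arcs G F)\<^esub> t \<longleftrightarrow> (s, t) \<in> (parcs G - F)\<^sup>*"
      using reachable_with_proj_iff[of "without_arcs G F" s t] GV sV by (auto simp: without_arcs_def)
    moreover have "s \<rightarrow>\<^sup>*\<^bsub>with_proj (without_arcs H F)\<^esub> t \<longleftrightarrow> (s, t) \<in> (parcs H - F)\<^sup>*"
      using reachable_with_proj_iff[of "without_arcs H F" s t] GV H sV by (auto simp: without_arcs_def)
    ultimately show ?thesis by simp
  qed
  then show ?thesis unfolding ft_reach_subgraph_def using sub by blast
qed

text \<open>Shared by the existence proof and the program. The slack constant is 1 because all of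
  \<open>P\<close> is kept.\<close>

lemma minimal_preserver:
  assumes G: "pair_fin_digraph G" and H: "pverts H = pverts G" "parcs H \<subseteq> parcs G"
    and P: "P \<subseteq> pverts G \<times> pverts G" and pres: "preserves 2 (parcs G) P (parcs H)"
    and min: "\<And>e. e \<in> parcs H \<Longrightarrow> \<not> preserves 2 (parcs G) P (parcs H - {e})"
  shows "ft_reach_subgraph_slack 1 2 G P H \<and>
    real (card (parcs H)) \<le> 812 * real (card (pverts G)) powr (4 / 3) * real (card P) powr (1 / 3)"
proof
  interpret pair_fin_digraph G by fact
  have wf: "pair_wf_digraph G" by unfold_locales
  have "ft_reach_subgraph 2 G P H" by (rule preserves_imp_ft_reach_subgraph[OF wf H P pres])
  then show "ft_reach_subgraph_slack 1 2 G P H" unfolding ft_reach_subgraph_slack_def by auto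
  have "parcs H \<subseteq> pverts G \<times> pverts G" using H(2) in_arcsD1 in_arcsD2 by auto
  then show "real (card (parcs H)) \<le> 812 * real (card (pverts G)) powr (4 / 3) * real (card P) powr (1 / 3)"
    using minimal_preserver_critical[OF pres min] P by (intro card_all_critical_powr) auto
qed

text \<open>The finite family of preservers inside \<open>E\<close> contains \<open>E\<close> itself
  and so has a minimal member. This serves vertices of an arbitrary type, whereas the program works
  on natural numbers.\<close>

lemma minimal_preserver_exists:
  assumes "finite E"
  obtains X where "X \<subseteq> E" "preserves k E P X" "\<forall>e \<in> X. \<not> preserves k E P (X - {e})"
proof -
  define A where "A = {X. X \<subseteq> E \<and> preserves k E P X}"
  have "finite A" using assms by (simp add: A_def)
  moreover have "E \<in> A" by (auto simp: preserves_def A_def)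
  then have "A \<noteq> {}" by auto
  ultimately obtain X where X: "X \<in> A" and min: "\<forall>Y \<in> A. Y \<subseteq> X \<longrightarrow> X = Y"
    using finite_has_minimal[of A] by blast
  show ?thesis
  proof (rule that)
    show "X \<subseteq> E" "preserves k E P X" using X by (simp_all add: A_def)
    show "\<forall>e \<in> X. \<not> preserves k E P (X - {e})"
    proof (rule ballI, rule notI)
      fix e assume e: "e \<in> X"
      assume "preserves k E P (X - {e})"
      then have "X - {e} \<in> A" using \<open>X \<subseteq> E\<close> by (auto simp: A_def)
      then have "X = X - {e}" using min by (meson Diff_subset)
      then show False using e by auto
    qed
  qed
qed


section \<open>Time-bounded execution\<close>

text \<open>A weakest precondition for total correctness with a time budget. \<open>T\<close> is
  only an upper bound, so exact costs need not be tracked.\<close>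

definition wpt :: "prog \<Rightarrow> nat \<Rightarrow> (store \<Rightarrow> bool) \<Rightarrow> store \<Rightarrow> bool" where
  "wpt p T Q \<sigma> \<longleftrightarrow> (\<exists>t \<tau>. exec p \<sigma> t \<tau> \<and> t \<le> T \<and> Q \<tau>)"

lemma wpt_weaken:
  assumes "wpt p T Q \<sigma>" "T \<le> T'" "\<And>\<tau>. Q \<tau> \<Longrightarrow> Q' \<tau>"
  shows "wpt p T' Q' \<sigma>"
  using assms unfolding wpt_def by (meson le_trans)

lemma wpt_Skip: "Q \<sigma> \<Longrightarrow> 1 \<le> T \<Longrightarrow> wpt Skip T Q \<sigma>"
  unfolding wpt_def using exec_Skip by blast

lemma wpt_Assign: "Q (set_scalar x (expr_val e \<sigma>) \<sigma>) \<Longrightarrow> 1 + expr_cost e \<le> T \<Longrightarrow> wpt (Assign x e) T Q \<sigma>"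
  unfolding wpt_def using exec_Assign by blast

lemma wpt_Store: "Q (set_elem a (expr_val i \<sigma>) (expr_val e \<sigma>) \<sigma>) \<Longrightarrow> 1 + expr_cost i + expr_cost e \<le> T \<Longrightarrow>
    wpt (Store a i e) T Q \<sigma>"
  unfolding wpt_def using exec_Store by blast

lemma wpt_Seq:
  assumes "wpt p T1 (wpt q T2 Q) \<sigma>"
  shows "wpt (Seq p q) (T1 + T2) Q \<sigma>"
proof -
  obtain t1 \<tau> where 1: "exec p \<sigma> t1 \<tau>" "t1 \<le> T1" "wpt q T2 Q \<tau>" using assms unfolding wpt_def by blast
  obtain t2 \<rho> where 2: "exec q \<tau> t2 \<rho>" "t2 \<le> T2" "Q \<rho>" using 1(3) unfolding wpt_def by blast
  have "exec (Seq p q) \<sigma> (t1 + t2) \<rho>" using 1(1) 2(1) by (rule exec_Seq)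
  moreover have "t1 + t2 \<le> T1 + T2" using 1(2) 2(2) by (rule add_mono)
  ultimately show ?thesis using 2(3) unfolding wpt_def by blast
qed

lemma wpt_Cond:
  assumes "expr_val e \<sigma> \<noteq> 0 \<Longrightarrow> wpt p (T - (1 + expr_cost e)) Q \<sigma>"
    and "expr_val e \<sigma> = 0 \<Longrightarrow> wpt q (T - (1 + expr_cost e)) Q \<sigma>" and "1 + expr_cost e \<le> T"
  shows "wpt (Cond e p q) T Q \<sigma>"
proof (cases "expr_val e \<sigma> = 0")
  case True
  then obtain t \<tau> where t: "exec q \<sigma> t \<tau>" "t \<le> T - (1 + expr_cost e)" "Q \<tau>"
    using assms(2) unfolding wpt_def by blast
  have "1 + expr_cost e + t \<le> T" using t(2) assms(3) by linarith
  then show ?thesis using exec_Cond_False[OF True t(1)] t(3) unfolding wpt_def by blast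
next
  case False
  then obtain t \<tau> where t: "exec p \<sigma> t \<tau>" "t \<le> T - (1 + expr_cost e)" "Q \<tau>"
    using assms(1) unfolding wpt_def by blast
  have "1 + expr_cost e + t \<le> T" using t(2) assms(3) by linarith
  then show ?thesis using exec_Cond_True[OF False t(1)] t(3) unfolding wpt_def by blast
qed

lemma scalar_set_scalar [simp]: "scalar (set_scalar x k \<sigma>) y = (if y = x then k else scalar \<sigma> y)"
  by (simp add: set_scalar_def)

lemma scalar_set_elem [simp]: "scalar (set_elem a i k \<sigma>) = scalar \<sigma>"
  by (simp add: set_elem_def)

lemma arr_set_scalar [simp]: "arr (set_scalar x k \<sigma>) = arr \<sigma>"
  by (simp add: set_scalar_def)

lemma arr_set_elem [simp]: "arr (set_elem a i k \<sigma>) b = (if b = a then (arr \<sigma> a)(i := k) else arr \<sigma> b)"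
  by (simp add: set_elem_def)

primrec writes :: "prog \<Rightarrow> vname set" where
  "writes Skip = {}"
| "writes (Assign x e) = {x}"
| "writes (Store a i e) = {}"
| "writes (Seq p q) = writes p \<union> writes q"
| "writes (Cond e p q) = writes p \<union> writes q"
| "writes (While e p) = writes p"

primrec writes_arr :: "prog \<Rightarrow> vname set" where
  "writes_arr Skip = {}"
| "writes_arr (Assign x e) = {}"
| "writes_arr (Store a i e) = {a}"
| "writes_arr (Seq p q) = writes_arr p \<union> writes_arr q"
| "writes_arr (Cond e p q) = writes_arr p \<union> writes_arr q"
| "writes_arr (While e p) = writes_arr p"

text \<open>The frame condition: with \<open>writes\<close> and \<open>writes_arr\<close> it carries
  all facts about untouched variables and arrays across a program.\<close>

definition agree :: "vname set \<Rightarrow> vname set \<Rightarrow> store \<Rightarrow> store \<Rightarrow> bool" where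
  "agree X A \<sigma> \<tau> \<longleftrightarrow> (\<forall>x. x \<notin> X \<longrightarrow> scalar \<tau> x = scalar \<sigma> x) \<and> (\<forall>a. a \<notin> A \<longrightarrow> arr \<tau> a = arr \<sigma> a)"

lemma exec_agree: "exec p \<sigma> t \<tau> \<Longrightarrow> agree (writes p) (writes_arr p) \<sigma> \<tau>"
  by (induction rule: exec.induct) (simp_all add: agree_def)

lemma agree_trans: "agree X A \<rho> \<sigma> \<Longrightarrow> agree Y B \<sigma> \<tau> \<Longrightarrow> Y \<subseteq> X \<Longrightarrow> B \<subseteq> A \<Longrightarrow> agree X A \<rho> \<tau>"
  unfolding agree_def by (metis subsetD)

lemma wpt_agree:
  assumes "wpt p T Q \<sigma>"
  shows "wpt p T (\<lambda>\<tau>. agree (writes p) (writes_arr p) \<sigma> \<tau> \<and> Q \<tau>) \<sigma>"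
  using assms exec_agree unfolding wpt_def by blast

text \<open>By truncated subtraction the test is nonzero exactly while the counter is below the
  bound.\<close>

definition for_loop :: "vname \<Rightarrow> expr \<Rightarrow> prog \<Rightarrow> prog" where
  "for_loop i e body =
     Seq (Assign i (Const 0)) (While (Sub e (Var i)) (Seq body (Assign i (Add (Var i) (Const 1)))))"

lemma writes_for_loop [simp]: "writes (for_loop i e p) = insert i (writes p)" "writes_arr (for_loop i e p) = writes_arr p"
  by (auto simp: for_loop_def)

text \<open>Induction on the number of rounds left. A round costs at most \<open>T\<close> for the
  body, 4 for the increment and 6 for the test; the final test costs at most 6 and the
  initialisation 2. \<open>I\<close> must be insensitive to the counter, which is changed outside
  the body.\<close>

lemma wpt_for_loop:
  assumes i: "i \<notin> writes body"
    and e: "\<And>\<tau>. agree (insert i (writes body)) (writes_arr body) \<sigma> \<tau> \<Longrightarrow> expr_val e \<tau> = N"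
    and cost: "expr_cost e \<le> 3"
    and I: "\<And>k v \<tau>. I k \<tau> \<Longrightarrow> I k (set_scalar i v \<tau>)"
    and init: "I 0 \<sigma>"
    and body: "\<And>k \<tau>. k < N \<Longrightarrow> agree (insert i (writes body)) (writes_arr body) \<sigma> \<tau> \<Longrightarrow> scalar \<tau> i = k \<Longrightarrow>
      I k \<tau> \<Longrightarrow> wpt body T (I (Suc k)) \<tau>"
  shows "wpt (for_loop i e body) ((N + 1) * (T + 10)) (\<lambda>\<tau>. agree (insert i (writes body)) (writes_arr body) \<sigma> \<tau> \<and> I N \<tau>) \<sigma>"
proof -
  let ?agree = "agree (insert i (writes body)) (writes_arr body)"
  let ?loop = "While (Sub e (Var i)) (Seq body (Assign i (Add (Var i) (Const 1))))"
  have loop: "wpt ?loop ((N - k) * (T + 10) + 6) (\<lambda>\<tau>. ?agree \<sigma> \<tau> \<and> I N \<tau>) \<tau>"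
    if "k \<le> N" "?agree \<sigma> \<tau>" "scalar \<tau> i = k" "I k \<tau>" for k \<tau>
    using that
  proof (induction "N - k" arbitrary: k \<tau>)
    case 0
    then have k: "k = N" by simp
    have "expr_val (Sub e (Var i)) \<tau> = 0" using e[OF 0(3)] 0(4) k by simp
    then have "exec ?loop \<tau> (1 + expr_cost (Sub e (Var i))) \<tau>" by (rule exec_While_False)
    moreover have "1 + expr_cost (Sub e (Var i)) \<le> (N - k) * (T + 10) + 6" using cost by simp
    moreover have "?agree \<sigma> \<tau> \<and> I N \<tau>" using 0 k by simp
    ultimately show ?case unfolding wpt_def by blast
  next
    case (Suc d)
    then have k: "k < N" "d = N - Suc k" by auto
    obtain t \<tau>1 where t: "exec body \<tau> t \<tau>1" "t \<le> T" "I (Suc k) \<tau>1"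
      using body[OF k(1) Suc.prems(2,3,4)] unfolding wpt_def by blast
    have a1: "agree (writes body) (writes_arr body) \<tau> \<tau>1" using t(1) by (rule exec_agree)
    then have s1: "scalar \<tau>1 i = k" using i Suc.prems(3) by (simp add: agree_def)
    let ?\<tau>2 = "set_scalar i (Suc k) \<tau>1"
    have "exec (Assign i (Add (Var i) (Const 1))) \<tau>1 4 ?\<tau>2"
      using exec_Assign[of i "Add (Var i) (Const 1)" \<tau>1] s1 by (simp add: numeral_eq_Suc)
    with t(1) have e2: "exec (Seq body (Assign i (Add (Var i) (Const 1)))) \<tau> (t + 4) ?\<tau>2" by (rule exec_Seq)
    have "?agree \<tau> ?\<tau>2" using a1 by (simp add: agree_def)
    with Suc.prems(2) have "?agree \<sigma> ?\<tau>2" by (rule agree_trans) auto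
    moreover have "I (Suc k) ?\<tau>2" using t(3) by (rule I)
    ultimately have "wpt ?loop ((N - Suc k) * (T + 10) + 6) (\<lambda>\<tau>. ?agree \<sigma> \<tau> \<and> I N \<tau>) ?\<tau>2"
      using k by (intro Suc.hyps(1)) auto
    then obtain t' \<rho> where t': "exec ?loop ?\<tau>2 t' \<rho>" "t' \<le> (N - Suc k) * (T + 10) + 6" "?agree \<sigma> \<rho> \<and> I N \<rho>"
      unfolding wpt_def by blast
    have "expr_val (Sub e (Var i)) \<tau> \<noteq> 0" using e[OF Suc.prems(2)] Suc.prems(3) k(1) by simp
    from exec_While_True[OF this e2 t'(1)]
    have "exec ?loop \<tau> (1 + expr_cost (Sub e (Var i)) + (t + 4) + t') \<rho>" .
    moreover have "N - k = Suc (N - Suc k)" using k(1) by simp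
    then have "1 + expr_cost (Sub e (Var i)) + (t + 4) + t' \<le> (N - k) * (T + 10) + 6"
      using t(2) t'(2) cost by simp
    ultimately show ?case using t'(3) unfolding wpt_def by blast
  qed
  let ?\<sigma>1 = "set_scalar i 0 \<sigma>"
  have "wpt ?loop ((N - 0) * (T + 10) + 6) (\<lambda>\<tau>. ?agree \<sigma> \<tau> \<and> I N \<tau>) ?\<sigma>1"
    by (rule loop) (use init I in \<open>simp_all add: agree_def\<close>)
  then have "wpt (Assign i (Const 0)) 2 (wpt ?loop ((N - 0) * (T + 10) + 6) (\<lambda>\<tau>. ?agree \<sigma> \<tau> \<and> I N \<tau>)) \<sigma>"
    by (intro wpt_Assign) simp_all
  then have "wpt (for_loop i e body) (2 + ((N - 0) * (T + 10) + 6)) (\<lambda>\<tau>. ?agree \<sigma> \<tau> \<and> I N \<tau>) \<sigma>"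
    unfolding for_loop_def by (rule wpt_Seq)
  then show ?thesis by (rule wpt_weaken) simp_all
qed


section \<open>Greedy deletion as a program\<close>

text \<open>The sum of the two truncated differences is the absolute difference.\<close>

definition neq :: "vname \<Rightarrow> vname \<Rightarrow> expr" where
  "neq x y = Add (Sub (Var x) (Var y)) (Sub (Var y) (Var x))"

lemma neq_simps [simp]: "expr_val (neq x y) \<sigma> = 0 \<longleftrightarrow> scalar \<sigma> x = scalar \<sigma> y" "expr_cost (neq x y) = 7"
  by (auto simp: neq_def)

text \<open>The indices \<open>f\<close> and \<open>g\<close> are the faults, and \<open>x\<close>
  is the edge whose deletion is being tried.\<close>

definition relax :: prog where
  "relax = Cond (Elem ''del'' (Var ''i'')) Skip
     (Cond (neq ''i'' ''f'') (Cond (neq ''i'' ''g'') (Cond (neq ''i'' ''x'')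
       (Cond (Elem ''vis'' (Elem ''Efst'' (Var ''i''))) (Store ''vis'' (Elem ''Esnd'' (Var ''i'')) (Const 1)) Skip)
       Skip) Skip) Skip)"

text \<open>Reachability in the manner of Bellman and Ford: \<open>m\<close> rounds over all edges,
  since shortest paths have at most \<open>m\<close> edges.\<close>

definition search :: prog where
  "search = Seq (for_loop ''i'' (Var ''n'') (Store ''vis'' (Var ''i'') (Const 0)))
     (Seq (Store ''vis'' (Elem ''Pfst'' (Var ''j'')) (Const 1))
       (for_loop ''r'' (Var ''m'') (for_loop ''i'' (Var ''m'') relax)))"

text \<open>The first search runs with \<open>x = m\<close>, which excludes no edge, the second with
  \<open>x = e\<close>. The first answer is saved in \<open>a\<close> because the second search
  overwrites \<open>vis\<close>.\<close>

definition test :: prog where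
  "test = Seq (Assign ''x'' (Var ''m'')) (Seq search
     (Seq (Assign ''a'' (Elem ''vis'' (Elem ''Psnd'' (Var ''j'')))) (Seq (Assign ''x'' (Var ''e'')) (Seq search
       (Cond (Var ''a'') (Cond (Elem ''vis'' (Elem ''Psnd'' (Var ''j''))) Skip (Assign ''c'' (Const 1))) Skip)))))"

definition all_tests :: prog where
  "all_tests = Seq (Assign ''c'' (Const 0)) (for_loop ''j'' (Var ''q'')
     (for_loop ''f'' (Add (Var ''m'') (Const 1)) (for_loop ''g'' (Add (Var ''m'') (Const 1)) test)))"

text \<open>A kept edge is never reconsidered, so it is appended to the output at once.\<close>

definition prune_step :: prog where
  "prune_step = Seq all_tests (Cond (Var ''c'')
     (Seq (Store ''Hfst'' (Var ''h'') (Elem ''Efst'' (Var ''e'')))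
       (Seq (Store ''Hsnd'' (Var ''h'') (Elem ''Esnd'' (Var ''e''))) (Assign ''h'' (Add (Var ''h'') (Const 1)))))
     (Store ''del'' (Var ''e'') (Const 1)))"

definition prune :: prog where
  "prune = for_loop ''e'' (Var ''m'') prune_step"

lemma relax_writes [simp]: "writes relax = {}" "writes_arr relax = {''vis''}"
  by (auto simp: relax_def)

lemma search_writes [simp]: "writes search = {''i'', ''r''}" "writes_arr search = {''vis''}"
  by (auto simp: search_def)

lemma test_writes [simp]: "writes test = {''i'', ''r'', ''x'', ''a'', ''c''}" "writes_arr test = {''vis''}"
  by (auto simp: test_def)

lemma all_tests_writes [simp]:
  "writes all_tests = {''i'', ''r'', ''x'', ''a'', ''c'', ''j'', ''f'', ''g''}" "writes_arr all_tests = {''vis''}"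
  by (auto simp: all_tests_def)

lemma prune_step_writes [simp]:
  "writes prune_step = {''i'', ''r'', ''x'', ''a'', ''c'', ''j'', ''f'', ''g'', ''h''}"
  "writes_arr prune_step = {''vis'', ''Hfst'', ''Hsnd'', ''del''}"
  by (auto simp: prune_step_def)

text \<open>\<open>D\<close> is the array of deletion marks and \<open>X\<close> a set of excluded
  indices. An index beyond the list excludes nothing.\<close>

definition live :: "(nat \<times> nat) list \<Rightarrow> (nat \<Rightarrow> nat) \<Rightarrow> nat set \<Rightarrow> (nat \<times> nat) set" where
  "live es D X = {es ! i | i. i < length es \<and> D i = 0 \<and> i \<notin> X}"

section \<open>Correctness and running time of greedy deletion\<close>

locale pruning =
  fixes n :: nat and es ps :: "(nat \<times> nat) list"
  assumes es: "distinct es" "set es \<subseteq> {..<n} \<times> {..<n}" and ps: "set ps \<subseteq> {..<n} \<times> {..<n}"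
begin

definition input_in :: "store \<Rightarrow> bool" where
  "input_in \<sigma> \<longleftrightarrow> scalar \<sigma> ''n'' = n \<and> scalar \<sigma> ''m'' = length es \<and> scalar \<sigma> ''q'' = length ps \<and>
     arr \<sigma> ''Efst'' = nth_or_0 (map fst es) \<and> arr \<sigma> ''Esnd'' = nth_or_0 (map snd es) \<and>
     arr \<sigma> ''Pfst'' = nth_or_0 (map fst ps) \<and> arr \<sigma> ''Psnd'' = nth_or_0 (map snd ps)"

lemma input_in_agree:
  "input_in \<sigma> \<Longrightarrow> agree X A \<sigma> \<tau> \<Longrightarrow> X \<inter> {''n'', ''m'', ''q''} = {} \<Longrightarrow>
    A \<inter> {''Efst'', ''Esnd'', ''Pfst'', ''Psnd''} = {} \<Longrightarrow> input_in \<tau>"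
  by (auto simp: input_in_def agree_def)

lemma finite_live: "finite (live es D X)" and card_live: "card (live es D X) \<le> length es"
proof -
  have "live es D X \<subseteq> set es" by (auto simp: live_def)
  then show "finite (live es D X)" "card (live es D X) \<le> length es"
    using finite_subset[of "live es D X" "set es"] card_mono[of "set es" "live es D X"] card_length[of es] by auto
qed

lemma wpt_relax:
  assumes "input_in \<sigma>" "scalar \<sigma> ''i'' = i" "i < length es"
  shows "wpt relax 40 (\<lambda>\<tau>. arr \<tau> ''vis'' =
    (if arr \<sigma> ''del'' i = 0 \<and> i \<notin> {scalar \<sigma> ''f'', scalar \<sigma> ''g'', scalar \<sigma> ''x''} \<and> arr \<sigma> ''vis'' (fst (es ! i)) \<noteq> 0
     then (arr \<sigma> ''vis'')(snd (es ! i) := 1) else arr \<sigma> ''vis'')) \<sigma>"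
  unfolding relax_def
  by (intro wpt_Cond wpt_Skip wpt_Store)
    (use assms in \<open>simp_all add: input_in_def nth_or_0_def\<close>)

text \<open>Marks are updated in place and may run ahead of the round count, so the marked set is
  only bounded: from above by reachability, from below by reachability within \<open>r\<close>
  steps.\<close>

definition explored :: "(nat \<times> nat) set \<Rightarrow> nat \<Rightarrow> nat \<Rightarrow> store \<Rightarrow> bool" where
  "explored R s r \<tau> \<longleftrightarrow> (\<forall>v<n. arr \<tau> ''vis'' v \<noteq> 0 \<longrightarrow> (s, v) \<in> R\<^sup>*) \<and>
     (\<forall>k v. k \<le> r \<longrightarrow> (s, v) \<in> R ^^ k \<longrightarrow> arr \<tau> ''vis'' v \<noteq> 0)"

lemma wpt_round:
  assumes inp: "input_in \<sigma>" and R: "R = live es (arr \<sigma> ''del'') {scalar \<sigma> ''f'', scalar \<sigma> ''g'', scalar \<sigma> ''x''}"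
    and expl: "explored R s r \<sigma>"
  shows "wpt (for_loop ''i'' (Var ''m'') relax) ((length es + 1) * (40 + 10)) (explored R s (Suc r)) \<sigma>"
proof -
  let ?X = "{scalar \<sigma> ''f'', scalar \<sigma> ''g'', scalar \<sigma> ''x''}"
  \<comment> \<open>The tail must be reachable within \<open>r\<close> steps, not merely marked: a
    vertex first marked in this round may have outgoing edges that were scanned before.\<close>
  let ?done = "\<lambda>k \<tau>. \<forall>i<k. arr \<sigma> ''del'' i = 0 \<longrightarrow> i \<notin> ?X \<longrightarrow> arr \<tau> ''vis'' (fst (es ! i)) \<noteq> 0 \<longrightarrow>
    (\<exists>k\<le>r. (s, fst (es ! i)) \<in> R ^^ k) \<longrightarrow> arr \<tau> ''vis'' (snd (es ! i)) \<noteq> 0"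
  let ?I = "\<lambda>k \<tau>. explored R s r \<tau> \<and> ?done k \<tau>"
  have "wpt (for_loop ''i'' (Var ''m'') relax) ((length es + 1) * (40 + 10))
    (\<lambda>\<tau>. agree (insert ''i'' (writes relax)) (writes_arr relax) \<sigma> \<tau> \<and> ?I (length es) \<tau>) \<sigma>"
  proof (rule wpt_for_loop[where I = ?I])
    show "''i'' \<notin> writes relax" "expr_cost (Var ''m'') \<le> 3" by simp_all
    show "expr_val (Var ''m'') \<tau> = length es" if "agree (insert ''i'' (writes relax)) (writes_arr relax) \<sigma> \<tau>" for \<tau>
      using that inp by (simp add: agree_def input_in_def)
    show "?I k (set_scalar ''i'' v \<tau>)" if "?I k \<tau>" for k v \<tau>
      using that by (simp add: explored_def)
    show "?I 0 \<sigma>" using expl by simp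
    fix k \<tau>
    assume k: "k < length es" "scalar \<tau> ''i'' = k" and I: "?I k \<tau>"
      and ag: "agree (insert ''i'' (writes relax)) (writes_arr relax) \<sigma> \<tau>"
    have inp': "input_in \<tau>" using inp ag by (rule input_in_agree) simp_all
    have eqs: "arr \<tau> ''del'' = arr \<sigma> ''del''" "{scalar \<tau> ''f'', scalar \<tau> ''g'', scalar \<tau> ''x''} = ?X"
      using ag by (simp_all add: agree_def)
    obtain u v where uv: "es ! k = (u, v)" by force
    then have un: "u < n" using es(2) nth_mem[OF k(1)] by auto
    show "wpt relax 40 (?I (Suc k)) \<tau>"
    proof (rule wpt_weaken[OF wpt_relax[OF inp' k(2,1)] order_refl])
      fix \<rho> :: store
      assume rho: "arr \<rho> ''vis'' =
        (if arr \<tau> ''del'' k = 0 \<and> k \<notin> {scalar \<tau> ''f'', scalar \<tau> ''g'', scalar \<tau> ''x''} \<and> arr \<tau> ''vis'' (fst (es ! k)) \<noteq> 0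
         then (arr \<tau> ''vis'')(snd (es ! k) := 1) else arr \<tau> ''vis'')"
      show "?I (Suc k) \<rho>"
      proof (cases "arr \<sigma> ''del'' k = 0 \<and> k \<notin> ?X \<and> arr \<tau> ''vis'' u \<noteq> 0")
        case True
        have vis: "arr \<rho> ''vis'' = (arr \<tau> ''vis'')(v := 1)"
          unfolding rho eqs uv fst_conv snd_conv by (rule if_P) (use True in blast)
        have "(u, v) \<in> R" using True uv k(1) unfolding R live_def by (auto intro!: exI[of _ k])
        moreover have "(s, u) \<in> R\<^sup>*" using I True un by (simp add: explored_def)
        ultimately have sv: "(s, v) \<in> R\<^sup>*" by (rule rtrancl.rtrancl_into_rtrancl[rotated])
        have e': "explored R s r \<rho>" using I sv unfolding explored_def vis by simp
        have le: "arr \<rho> ''vis'' (snd (es ! i)) \<noteq> 0" if i: "i < Suc k" "arr \<sigma> ''del'' i = 0" "i \<notin> ?X"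
          "\<exists>k\<le>r. (s, fst (es ! i)) \<in> R ^^ k" for i
        proof (cases "i = k")
          case False
          then have "i < k" using i(1) by simp
          moreover have "arr \<tau> ''vis'' (fst (es ! i)) \<noteq> 0" using i(4) I unfolding explored_def by blast
          ultimately have "arr \<tau> ''vis'' (snd (es ! i)) \<noteq> 0" using i I by blast
          then show ?thesis unfolding vis by simp
        qed (simp add: vis uv)
        show ?thesis using e' le by blast
      next
        case False
        have vis: "arr \<rho> ''vis'' = arr \<tau> ''vis''"
          unfolding rho eqs uv fst_conv snd_conv by (rule if_not_P) (use False in blast)
        have "explored R s r \<rho>" using I unfolding explored_def vis by blast
        moreover have "?done (Suc k) \<rho>"
          unfolding vis less_Suc_eq using I False uv by auto
        ultimately show ?thesis by blast
      qed
    qed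
  qed
  then show ?thesis
  proof (rule wpt_weaken)
    fix \<tau>
    assume "agree (insert ''i'' (writes relax)) (writes_arr relax) \<sigma> \<tau> \<and> ?I (length es) \<tau>"
    then have e': "explored R s r \<tau>" and d: "?done (length es) \<tau>" by auto
    have "arr \<tau> ''vis'' v \<noteq> 0" if kv: "k \<le> Suc r" "(s, v) \<in> R ^^ k" for k v
    proof (cases "k = Suc r")
      case True
      then obtain u where u: "(s, u) \<in> R ^^ r" "(u, v) \<in> R" using kv(2) by auto
      then obtain i where i: "es ! i = (u, v)" "i < length es" "arr \<sigma> ''del'' i = 0" "i \<notin> ?X"
        unfolding R live_def by auto
      have "arr \<tau> ''vis'' u \<noteq> 0" using e' u(1) unfolding explored_def by blast
      then show ?thesis using d i u(1) by (metis fst_conv order_refl snd_conv)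
    next
      case False
      then have "k \<le> r" using kv(1) by simp
      then show ?thesis using kv(2) e' unfolding explored_def by blast
    qed
    then show "explored R s (Suc r) \<tau>" using e' unfolding explored_def by blast
  qed simp
qed

definition search_time :: nat where
  "search_time = (n + 1) * (3 + 10) + (4 + (length es + 1) * ((length es + 1) * (40 + 10) + 10))"

lemma wpt_search:
  assumes inp: "input_in \<sigma>" and j: "scalar \<sigma> ''j'' = j" "j < length ps"
    and R: "R = live es (arr \<sigma> ''del'') {scalar \<sigma> ''f'', scalar \<sigma> ''g'', scalar \<sigma> ''x''}"
  shows "wpt search search_time (\<lambda>\<tau>. agree {''i'', ''r''} {''vis''} \<sigma> \<tau> \<and>
    (\<forall>v<n. arr \<tau> ''vis'' v \<noteq> 0 \<longleftrightarrow> (fst (ps ! j), v) \<in> R\<^sup>*)) \<sigma>"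
proof -
  let ?s = "fst (ps ! j)"
  let ?clear = "Store ''vis'' (Var ''i'') (Const 0)"
  let ?init = "Store ''vis'' (Elem ''Pfst'' (Var ''j'')) (Const 1)"
  let ?round = "for_loop ''i'' (Var ''m'') relax"
  have sn: "?s < n" using subsetD[OF ps nth_mem[OF j(2)]] by (simp add: mem_Times_iff)
  have 1: "wpt (for_loop ''i'' (Var ''n'') ?clear) ((n + 1) * (3 + 10))
    (\<lambda>\<tau>. agree (insert ''i'' (writes ?clear)) (writes_arr ?clear) \<sigma> \<tau> \<and> (\<forall>v<n. arr \<tau> ''vis'' v = 0)) \<sigma>"
  proof (rule wpt_for_loop[where I = "\<lambda>k \<tau>. \<forall>v<k. arr \<tau> ''vis'' v = 0"])
    show "expr_val (Var ''n'') \<tau> = n" if "agree (insert ''i'' (writes ?clear)) (writes_arr ?clear) \<sigma> \<tau>" for \<tau>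
      using that inp by (simp add: agree_def input_in_def)
    show "wpt ?clear 3 (\<lambda>\<tau>. \<forall>v<Suc k. arr \<tau> ''vis'' v = 0) \<tau>"
      if "scalar \<tau> ''i'' = k" "\<forall>v<k. arr \<tau> ''vis'' v = 0" for k \<tau>
      using that by (intro wpt_Store) (simp_all add: less_Suc_eq)
  qed simp_all
  have 3: "wpt (for_loop ''r'' (Var ''m'') ?round) ((length es + 1) * ((length es + 1) * (40 + 10) + 10))
    (\<lambda>\<tau>. agree (insert ''r'' (writes ?round)) (writes_arr ?round) \<rho> \<tau> \<and> explored R ?s (length es) \<tau>) \<rho>"
    if ag: "agree {''i''} {''vis''} \<sigma> \<rho>" and expl: "explored R ?s 0 \<rho>" for \<rho>
  proof (rule wpt_for_loop[where I = "explored R ?s"])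
    have inp': "input_in \<rho>" using inp ag by (rule input_in_agree) simp_all
    show "expr_val (Var ''m'') \<tau> = length es" if "agree (insert ''r'' (writes ?round)) (writes_arr ?round) \<rho> \<tau>" for \<tau>
      using that inp' by (simp add: agree_def input_in_def)
    show "explored R ?s 0 \<rho>" by fact
    fix k \<tau>
    assume ag': "agree (insert ''r'' (writes ?round)) (writes_arr ?round) \<rho> \<tau>" and e: "explored R ?s k \<tau>"
    show "wpt ?round ((length es + 1) * (40 + 10)) (explored R ?s (Suc k)) \<tau>"
    proof (rule wpt_round[OF _ _ e])
      show "input_in \<tau>" using inp' ag' by (rule input_in_agree) simp_all
      show "R = live es (arr \<tau> ''del'') {scalar \<tau> ''f'', scalar \<tau> ''g'', scalar \<tau> ''x''}"
        using ag ag' R by (simp add: agree_def)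
    qed
  qed (simp_all add: explored_def)
  have 2: "wpt ?init 4 (wpt (for_loop ''r'' (Var ''m'') ?round) ((length es + 1) * ((length es + 1) * (40 + 10) + 10))
    (\<lambda>\<tau>. explored R ?s (length es) \<tau>)) \<rho>"
    if ag: "agree {''i''} {''vis''} \<sigma> \<rho>" and z: "\<forall>v<n. arr \<rho> ''vis'' v = 0" for \<rho>
  proof (rule wpt_Store)
    have inp': "input_in \<rho>" using inp ag by (rule input_in_agree) simp_all
    have "scalar \<rho> ''j'' = j" using ag j(1) by (simp add: agree_def)
    then have v: "expr_val (Elem ''Pfst'' (Var ''j'')) \<rho> = ?s"
      using inp' j(2) by (simp add: input_in_def nth_or_0_def)
    let ?\<rho> = "set_elem ''vis'' (expr_val (Elem ''Pfst'' (Var ''j'')) \<rho>) (expr_val (Const 1) \<rho>) \<rho>"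
    have "agree {''i''} {''vis''} \<sigma> ?\<rho>" using ag by (simp add: agree_def)
    moreover have "explored R ?s 0 ?\<rho>" using z unfolding explored_def v by simp
    ultimately show "wpt (for_loop ''r'' (Var ''m'') ?round) ((length es + 1) * ((length es + 1) * (40 + 10) + 10))
      (explored R ?s (length es)) ?\<rho>" by (rule wpt_weaken[OF 3]) simp_all
  qed simp
  have "wpt search search_time (explored R ?s (length es)) \<sigma>"
    unfolding search_def search_time_def
  proof (rule wpt_Seq, rule wpt_weaken[OF 1 order_refl], rule wpt_Seq, rule 2)
    fix \<tau>
    assume "agree (insert ''i'' (writes ?clear)) (writes_arr ?clear) \<sigma> \<tau> \<and> (\<forall>v<n. arr \<tau> ''vis'' v = 0)"
    then show "agree {''i''} {''vis''} \<sigma> \<tau>" "\<forall>v<n. arr \<tau> ''vis'' v = 0" by simp_all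
  qed
  from wpt_agree[OF this] show ?thesis
  proof (rule wpt_weaken)
    fix \<tau>
    assume "agree (writes search) (writes_arr search) \<sigma> \<tau> \<and> explored R ?s (length es) \<tau>"
    then have ag: "agree {''i'', ''r''} {''vis''} \<sigma> \<tau>" and e: "explored R ?s (length es) \<tau>" by simp_all
    have "arr \<tau> ''vis'' v \<noteq> 0" if "(?s, v) \<in> R\<^sup>*" for v
    proof -
      \<comment> \<open>Reachability is witnessed by at most \<open>card R\<close> steps, so one
        round per input edge suffices.\<close>
      have fin: "finite R" and c: "card R \<le> length es" unfolding R by (rule finite_live, rule card_live)
      obtain k where "k \<le> card R" "(?s, v) \<in> R ^^ k" using \<open>(?s, v) \<in> R\<^sup>*\<close> rtrancl_finite_eq_relpow[OF fin] by auto
      then show ?thesis using e c unfolding explored_def by (meson le_trans)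
    qed
    then show "agree {''i'', ''r''} {''vis''} \<sigma> \<tau> \<and> (\<forall>v<n. arr \<tau> ''vis'' v \<noteq> 0 \<longleftrightarrow> (?s, v) \<in> R\<^sup>*)"
      using ag e unfolding explored_def by blast
  qed simp
qed

text \<open>A fault index equal to \<open>length es\<close> stands for no fault.\<close>

definition bad :: "(nat \<Rightarrow> nat) \<Rightarrow> nat \<Rightarrow> nat \<Rightarrow> nat \<Rightarrow> nat \<Rightarrow> bool" where
  "bad D e j f g \<longleftrightarrow> ps ! j \<in> (live es D {f, g, length es})\<^sup>* \<and> ps ! j \<notin> (live es D {f, g, e})\<^sup>*"

lemma wpt_test:
  assumes inp: "input_in \<sigma>" and j: "scalar \<sigma> ''j'' = j" "j < length ps"
    and D: "arr \<sigma> ''del'' = D" and e: "scalar \<sigma> ''e'' = e"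
    and fg: "scalar \<sigma> ''f'' = f" "scalar \<sigma> ''g'' = g"
  shows "wpt test (2 + (search_time + (4 + (2 + (search_time + 10)))))
    (\<lambda>\<tau>. scalar \<tau> ''c'' \<noteq> 0 \<longleftrightarrow> scalar \<sigma> ''c'' \<noteq> 0 \<or> bad D e j f g) \<sigma>"
proof -
  let ?t = "snd (ps ! j)"
  have tn: "?t < n" using subsetD[OF ps nth_mem[OF j(2)]] by (simp add: mem_Times_iff)
  have Psnd: "expr_val (Elem ''vis'' (Elem ''Psnd'' (Var ''j''))) \<tau> = arr \<tau> ''vis'' ?t"
    if "input_in \<tau>" "scalar \<tau> ''j'' = j" for \<tau>
    using that j(2) by (simp add: input_in_def nth_or_0_def)
  let ?Q = "\<lambda>\<tau>. scalar \<tau> ''c'' \<noteq> 0 \<longleftrightarrow> scalar \<sigma> ''c'' \<noteq> 0 \<or> bad D e j f g"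
  let ?ag = "agree {''x'', ''i'', ''r'', ''a''} {''vis''}"
  have m: "scalar \<sigma> ''m'' = length es" using inp by (simp add: input_in_def)
  show ?thesis unfolding test_def
  proof (rule wpt_Seq, rule wpt_Assign)
    let ?\<sigma>1 = "set_scalar ''x'' (expr_val (Var ''m'') \<sigma>) \<sigma>"
    have ag1: "?ag \<sigma> ?\<sigma>1" by (simp add: agree_def)
    have s1: "wpt search search_time (\<lambda>\<tau>. agree {''i'', ''r''} {''vis''} ?\<sigma>1 \<tau> \<and>
      (\<forall>v<n. arr \<tau> ''vis'' v \<noteq> 0 \<longleftrightarrow> (fst (ps ! j), v) \<in> (live es D {f, g, length es})\<^sup>*)) ?\<sigma>1"
    proof (rule wpt_search)
      show "input_in ?\<sigma>1" using inp ag1 by (rule input_in_agree) simp_all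
    qed (use D fg j m in simp_all)
    show "wpt (Seq search (Seq (Assign ''a'' (Elem ''vis'' (Elem ''Psnd'' (Var ''j''))))
        (Seq (Assign ''x'' (Var ''e'')) (Seq search
          (Cond (Var ''a'') (Cond (Elem ''vis'' (Elem ''Psnd'' (Var ''j''))) Skip (Assign ''c'' (Const 1))) Skip)))))
       (search_time + (4 + (2 + (search_time + 10)))) ?Q ?\<sigma>1"
    proof (rule wpt_Seq, rule wpt_weaken[OF s1 order_refl], rule wpt_Seq, rule wpt_Assign, rule wpt_Seq, rule wpt_Assign)
      fix \<tau>
      assume \<tau>: "agree {''i'', ''r''} {''vis''} ?\<sigma>1 \<tau> \<and>
        (\<forall>v<n. arr \<tau> ''vis'' v \<noteq> 0 \<longleftrightarrow> (fst (ps ! j), v) \<in> (live es D {f, g, length es})\<^sup>*)"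
      have ag2: "?ag \<sigma> \<tau>" by (rule agree_trans[OF ag1 conjunct1[OF \<tau>]]) auto
      have inp2: "input_in \<tau>" using inp ag2 by (rule input_in_agree) simp_all
      have j2: "scalar \<tau> ''j'' = j" using ag2 j by (simp add: agree_def)
      let ?\<sigma>3 = "set_scalar ''a'' (expr_val (Elem ''vis'' (Elem ''Psnd'' (Var ''j''))) \<tau>) \<tau>"
      let ?\<sigma>4 = "set_scalar ''x'' (expr_val (Var ''e'') ?\<sigma>3) ?\<sigma>3"
      have ag4: "?ag \<sigma> ?\<sigma>4" using ag2 by (simp add: agree_def)
      have inp4: "input_in ?\<sigma>4" using inp ag4 by (rule input_in_agree) simp_all
      have a4: "scalar ?\<sigma>4 ''a'' \<noteq> 0 \<longleftrightarrow> ps ! j \<in> (live es D {f, g, length es})\<^sup>*"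
        unfolding Psnd[OF inp2 j2] using \<tau> tn by simp
      have x4: "scalar ?\<sigma>4 ''x'' = e" using ag2 e by (simp add: agree_def)
      have s4: "wpt search search_time (\<lambda>\<tau>. agree {''i'', ''r''} {''vis''} ?\<sigma>4 \<tau> \<and>
        (\<forall>v<n. arr \<tau> ''vis'' v \<noteq> 0 \<longleftrightarrow> (fst (ps ! j), v) \<in> (live es D {f, g, e})\<^sup>*)) ?\<sigma>4"
      proof (rule wpt_search[OF inp4])
        show "scalar ?\<sigma>4 ''j'' = j" using j2 by simp
        show "j < length ps" by fact
        show "live es D {f, g, e} = live es (arr ?\<sigma>4 ''del'') {scalar ?\<sigma>4 ''f'', scalar ?\<sigma>4 ''g'', scalar ?\<sigma>4 ''x''}"
          unfolding x4 using ag4 D fg by (simp add: agree_def)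
      qed
      show "wpt (Seq search
          (Cond (Var ''a'') (Cond (Elem ''vis'' (Elem ''Psnd'' (Var ''j''))) Skip (Assign ''c'' (Const 1))) Skip))
        (search_time + 10) ?Q ?\<sigma>4"
      proof (rule wpt_Seq, rule wpt_weaken[OF s4 order_refl])
        fix \<rho> :: store
        assume \<rho>: "agree {''i'', ''r''} {''vis''} ?\<sigma>4 \<rho> \<and>
          (\<forall>v<n. arr \<rho> ''vis'' v \<noteq> 0 \<longleftrightarrow> (fst (ps ! j), v) \<in> (live es D {f, g, e})\<^sup>*)"
        have ag5: "?ag \<sigma> \<rho>" by (rule agree_trans[OF ag4 conjunct1[OF \<rho>]]) auto
        have inp5: "input_in \<rho>" using inp ag5 by (rule input_in_agree) simp_all
        have j5: "scalar \<rho> ''j'' = j" using ag5 j by (simp add: agree_def)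
        have c5: "scalar \<rho> ''c'' = scalar \<sigma> ''c''" using ag5 by (simp add: agree_def)
        have "scalar \<rho> ''a'' = scalar ?\<sigma>4 ''a''" using \<rho> by (simp add: agree_def)
        then have a5: "scalar \<rho> ''a'' \<noteq> 0 \<longleftrightarrow> ps ! j \<in> (live es D {f, g, length es})\<^sup>*" using a4 by simp
        have v5: "expr_val (Elem ''vis'' (Elem ''Psnd'' (Var ''j''))) \<rho> \<noteq> 0 \<longleftrightarrow> ps ! j \<in> (live es D {f, g, e})\<^sup>*"
          unfolding Psnd[OF inp5 j5] using \<rho> tn by simp
        show "wpt (Cond (Var ''a'') (Cond (Elem ''vis'' (Elem ''Psnd'' (Var ''j''))) Skip (Assign ''c'' (Const 1))) Skip)
          10 ?Q \<rho>"
        proof (rule wpt_Cond)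
          show "wpt (Cond (Elem ''vis'' (Elem ''Psnd'' (Var ''j''))) Skip (Assign ''c'' (Const 1)))
            (10 - (1 + expr_cost (Var ''a''))) ?Q \<rho>" if "expr_val (Var ''a'') \<rho> \<noteq> 0"
          proof (rule wpt_Cond)
            have a: "ps ! j \<in> (live es D {f, g, length es})\<^sup>*" using that a5 by simp
            show "wpt Skip (10 - (1 + expr_cost (Var ''a'')) - (1 + expr_cost (Elem ''vis'' (Elem ''Psnd'' (Var ''j''))))) ?Q \<rho>"
              if "expr_val (Elem ''vis'' (Elem ''Psnd'' (Var ''j''))) \<rho> \<noteq> 0"
              using that v5 c5 by (intro wpt_Skip) (simp_all add: bad_def)
            show "wpt (Assign ''c'' (Const 1)) (10 - (1 + expr_cost (Var ''a'')) - (1 + expr_cost (Elem ''vis'' (Elem ''Psnd'' (Var ''j''))))) ?Q \<rho>"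
              if "expr_val (Elem ''vis'' (Elem ''Psnd'' (Var ''j''))) \<rho> = 0"
              using that v5 a by (intro wpt_Assign) (simp_all add: bad_def)
          qed simp
          show "wpt Skip (10 - (1 + expr_cost (Var ''a''))) ?Q \<rho>" if "expr_val (Var ''a'') \<rho> = 0"
            using that a5 c5 by (intro wpt_Skip) (simp_all add: bad_def)
        qed simp
      qed
    qed simp_all
  qed simp
qed

definition all_tests_time :: nat where
  "all_tests_time = 2 + (length ps + 1) * ((length es + 1 + 1) *
     ((length es + 1 + 1) * (2 + (search_time + (4 + (2 + (search_time + 10)))) + 10) + 10) + 10)"

text \<open>Each of the three nested loops accumulates one bounded existential quantifier in
  \<open>c\<close>, which is reset only at the very beginning. The loops are treated from the inside
  outwards.\<close>

lemma wpt_all_tests: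
  assumes inp: "input_in \<sigma>" and D: "arr \<sigma> ''del'' = D" and e: "scalar \<sigma> ''e'' = e"
  shows "wpt all_tests all_tests_time
    (\<lambda>\<tau>. scalar \<tau> ''c'' \<noteq> 0 \<longleftrightarrow> (\<exists>j<length ps. \<exists>f<length es + 1. \<exists>g<length es + 1. bad D e j f g)) \<sigma>"
proof -
  let ?m = "length es + 1"
  let ?Tt = "2 + (search_time + (4 + (2 + (search_time + 10))))"
  let ?g = "for_loop ''g'' (Add (Var ''m'') (Const 1)) test"
  let ?f = "for_loop ''f'' (Add (Var ''m'') (Const 1)) ?g"
  let ?j = "for_loop ''j'' (Var ''q'') ?f"
  have lg: "wpt ?g ((?m + 1) * (?Tt + 10))
    (\<lambda>\<tau>. scalar \<tau> ''c'' \<noteq> 0 \<longleftrightarrow> scalar \<rho> ''c'' \<noteq> 0 \<or> (\<exists>g<?m. bad D e j f g)) \<rho>"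
    if inp: "input_in \<rho>" and D: "arr \<rho> ''del'' = D" and e: "scalar \<rho> ''e'' = e"
      and jf: "scalar \<rho> ''j'' = j" "j < length ps" "scalar \<rho> ''f'' = f" for \<rho> j f
  proof -
    let ?I = "\<lambda>k \<tau>. scalar \<tau> ''c'' \<noteq> 0 \<longleftrightarrow> scalar \<rho> ''c'' \<noteq> 0 \<or> (\<exists>g<k. bad D e j f g)"
    have "wpt ?g ((?m + 1) * (?Tt + 10))
      (\<lambda>\<tau>. agree (insert ''g'' (writes test)) (writes_arr test) \<rho> \<tau> \<and> ?I ?m \<tau>) \<rho>"
    proof (rule wpt_for_loop[where I = ?I])
      show "expr_val (Add (Var ''m'') (Const 1)) \<tau> = ?m" if "agree (insert ''g'' (writes test)) (writes_arr test) \<rho> \<tau>" for \<tau>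
        using that inp by (simp add: agree_def input_in_def)
      fix k \<tau>
      assume ag: "agree (insert ''g'' (writes test)) (writes_arr test) \<rho> \<tau>" and k: "scalar \<tau> ''g'' = k" and I: "?I k \<tau>"
      have "input_in \<tau>" using inp ag by (rule input_in_agree) simp_all
      then have "wpt test ?Tt (\<lambda>\<tau>'. scalar \<tau>' ''c'' \<noteq> 0 \<longleftrightarrow> scalar \<tau> ''c'' \<noteq> 0 \<or> bad D e j f k) \<tau>"
        by (rule wpt_test) (use ag D e jf k in \<open>simp_all add: agree_def\<close>)
      then show "wpt test ?Tt (?I (Suc k)) \<tau>"
        by (rule wpt_weaken) (use I in \<open>unfold Ex_less_Suc, blast+\<close>)
    qed simp_all
    then show ?thesis by (rule wpt_weaken) simp_all
  qed
  have lf: "wpt ?f ((?m + 1) * ((?m + 1) * (?Tt + 10) + 10))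
    (\<lambda>\<tau>. scalar \<tau> ''c'' \<noteq> 0 \<longleftrightarrow> scalar \<rho> ''c'' \<noteq> 0 \<or> (\<exists>f<?m. \<exists>g<?m. bad D e j f g)) \<rho>"
    if inp: "input_in \<rho>" and D: "arr \<rho> ''del'' = D" and e: "scalar \<rho> ''e'' = e"
      and j: "scalar \<rho> ''j'' = j" "j < length ps" for \<rho> j
  proof -
    let ?I = "\<lambda>k \<tau>. scalar \<tau> ''c'' \<noteq> 0 \<longleftrightarrow> scalar \<rho> ''c'' \<noteq> 0 \<or> (\<exists>f<k. \<exists>g<?m. bad D e j f g)"
    have "wpt ?f ((?m + 1) * ((?m + 1) * (?Tt + 10) + 10))
      (\<lambda>\<tau>. agree (insert ''f'' (writes ?g)) (writes_arr ?g) \<rho> \<tau> \<and> ?I ?m \<tau>) \<rho>"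
    proof (rule wpt_for_loop[where I = ?I])
      show "expr_val (Add (Var ''m'') (Const 1)) \<tau> = ?m" if "agree (insert ''f'' (writes ?g)) (writes_arr ?g) \<rho> \<tau>" for \<tau>
        using that inp by (simp add: agree_def input_in_def)
      fix k \<tau>
      assume ag: "agree (insert ''f'' (writes ?g)) (writes_arr ?g) \<rho> \<tau>" and k: "scalar \<tau> ''f'' = k" and I: "?I k \<tau>"
      have "input_in \<tau>" using inp ag by (rule input_in_agree) simp_all
      then have "wpt ?g ((?m + 1) * (?Tt + 10)) (\<lambda>\<tau>'. scalar \<tau>' ''c'' \<noteq> 0 \<longleftrightarrow> scalar \<tau> ''c'' \<noteq> 0 \<or> (\<exists>g<?m. bad D e j k g)) \<tau>"
        by (rule lg) (use ag D e j k in \<open>simp_all add: agree_def\<close>)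
      then show "wpt ?g ((?m + 1) * (?Tt + 10)) (?I (Suc k)) \<tau>"
        by (rule wpt_weaken) (use I in \<open>unfold Ex_less_Suc, blast+\<close>)
    qed simp_all
    then show ?thesis by (rule wpt_weaken) simp_all
  qed
  have lj: "wpt ?j ((length ps + 1) * ((?m + 1) * ((?m + 1) * (?Tt + 10) + 10) + 10))
    (\<lambda>\<tau>. scalar \<tau> ''c'' \<noteq> 0 \<longleftrightarrow> (\<exists>j<length ps. \<exists>f<?m. \<exists>g<?m. bad D e j f g)) \<rho>"
    if inp: "input_in \<rho>" and D: "arr \<rho> ''del'' = D" and e: "scalar \<rho> ''e'' = e" and c: "scalar \<rho> ''c'' = 0" for \<rho>
  proof -
    let ?I = "\<lambda>k \<tau>. scalar \<tau> ''c'' \<noteq> 0 \<longleftrightarrow> (\<exists>j<k. \<exists>f<?m. \<exists>g<?m. bad D e j f g)"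
    have "wpt ?j ((length ps + 1) * ((?m + 1) * ((?m + 1) * (?Tt + 10) + 10) + 10))
      (\<lambda>\<tau>. agree (insert ''j'' (writes ?f)) (writes_arr ?f) \<rho> \<tau> \<and> ?I (length ps) \<tau>) \<rho>"
    proof (rule wpt_for_loop[where I = ?I])
      show "expr_val (Var ''q'') \<tau> = length ps" if "agree (insert ''j'' (writes ?f)) (writes_arr ?f) \<rho> \<tau>" for \<tau>
        using that inp by (simp add: agree_def input_in_def)
      fix k \<tau>
      assume ag: "agree (insert ''j'' (writes ?f)) (writes_arr ?f) \<rho> \<tau>" and k: "k < length ps" "scalar \<tau> ''j'' = k"
        and I: "?I k \<tau>"
      have "input_in \<tau>" using inp ag by (rule input_in_agree) simp_all
      then have "wpt ?f ((?m + 1) * ((?m + 1) * (?Tt + 10) + 10))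
          (\<lambda>\<tau>'. scalar \<tau>' ''c'' \<noteq> 0 \<longleftrightarrow> scalar \<tau> ''c'' \<noteq> 0 \<or> (\<exists>f<?m. \<exists>g<?m. bad D e k f g)) \<tau>"
        by (rule lf) (use ag D e k in \<open>simp_all add: agree_def\<close>)
      then show "wpt ?f ((?m + 1) * ((?m + 1) * (?Tt + 10) + 10)) (?I (Suc k)) \<tau>"
        by (rule wpt_weaken) (use I in \<open>unfold Ex_less_Suc, blast+\<close>)
    qed (use c in simp_all)
    then show ?thesis by (rule wpt_weaken) simp_all
  qed
  show ?thesis unfolding all_tests_def all_tests_time_def
  proof (rule wpt_Seq, rule wpt_Assign, rule lj)
    let ?\<sigma>1 = "set_scalar ''c'' (expr_val (Const 0) \<sigma>) \<sigma>"
    have "agree {''c''} {} \<sigma> ?\<sigma>1" by (simp add: agree_def)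
    with inp show "input_in ?\<sigma>1" by (rule input_in_agree) simp_all
  qed (use D e in simp_all)
qed

text \<open>As \<open>es\<close> is distinct, excluding indices is the same as removing the
  corresponding edges.\<close>

lemma live_Un: "live es D (X \<union> Y) = live es D X - (!) es ` (Y \<inter> {..<length es})"
proof
  show "live es D (X \<union> Y) \<subseteq> live es D X - (!) es ` (Y \<inter> {..<length es})"
    using es(1) by (auto simp: live_def nth_eq_iff_index_eq)
  show "live es D X - (!) es ` (Y \<inter> {..<length es}) \<subseteq> live es D (X \<union> Y)"
    by (auto simp: live_def)
qed

text \<open>No fault is encoded by \<open>length es\<close> twice, a single fault by its index
  twice, and two faults by their two indices.\<close>

lemma small_fault_indices:
  assumes "F \<subseteq> set es" "card F \<le> 2"
  shows "\<exists>f<length es + 1. \<exists>g<length es + 1. (!) es ` ({f, g} \<inter> {..<length es}) = F"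
proof -
  have fin: "finite F" using assms(1) by (rule finite_subset) simp
  consider "card F = 0" | "card F = 1" | "card F = 2" using assms(2) by linarith
  then show ?thesis
  proof cases
    case 1
    then have "F = {}" using fin by simp
    then show ?thesis by (intro exI[of _ "length es"] conjI) simp_all
  next
    case 2
    then obtain a where a: "F = {a}" by (rule card_1_singletonE)
    then obtain f where f: "f < length es" "es ! f = a" using assms(1) by (auto simp: in_set_conv_nth)
    show ?thesis
    proof (intro exI conjI)
      show "(!) es ` ({f, f} \<inter> {..<length es}) = F" using f a by auto
    qed (use f in simp_all)
  next
    case 3
    then obtain a b where ab: "F = {a, b}" by (auto simp: card_2_iff)
    then obtain f g where fg: "f < length es" "es ! f = a" "g < length es" "es ! g = b"
      using assms(1) by (auto simp: in_set_conv_nth)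
    show ?thesis
    proof (intro exI conjI)
      show "(!) es ` ({f, g} \<inter> {..<length es}) = F" using fg ab by auto
    qed (use fg in simp_all)
  qed
qed

text \<open>The program only compares the live graph with and without \<open>e\<close>. Since the
  live graph is still a preserver, this amounts to comparing the graph without \<open>e\<close> with
  the original one.\<close>

lemma bad_iff:
  assumes pres: "preserves 2 (set es) (set ps) (live es D {})" and e: "e < length es"
  shows "(\<exists>j<length ps. \<exists>f<length es + 1. \<exists>g<length es + 1. bad D e j f g) \<longleftrightarrow>
    \<not> preserves 2 (set es) (set ps) (live es D {} - {es ! e})"
proof -
  let ?L = "live es D {}" and ?fault = "\<lambda>f g. (!) es ` ({f, g} \<inter> {..<length es})"
  have LE: "?L \<subseteq> set es" by (auto simp: live_def)
  have L1: "live es D {f, g, length es} = ?L - ?fault f g" for f g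
    using live_Un[of D "{}" "{f, g, length es}"] by (simp add: Int_insert_left)
  have L2: "live es D {f, g, e} = ?L - {es ! e} - ?fault f g" for f g
    using live_Un[of D "{}" "{f, g, e}"] e by (auto simp: Int_insert_left)
  show ?thesis
  proof
    assume "\<exists>j<length ps. \<exists>f<length es + 1. \<exists>g<length es + 1. bad D e j f g"
    then obtain j f g where j: "j < length ps" and b: "bad D e j f g" by blast
    have F: "?fault f g \<subseteq> set es" "finite (?fault f g)" by auto
    have "card (?fault f g) \<le> card ({f, g} \<inter> {..<length es})" by (rule card_image_le) simp
    also have "\<dots> \<le> card {f, g}" by (rule card_mono) auto
    also have "\<dots> \<le> 2" by (simp add: card_insert_if)
    finally have c: "card (?fault f g) \<le> 2" .
    have "ps ! j \<in> (?L - ?fault f g)\<^sup>*" "ps ! j \<notin> (?L - {es ! e} - ?fault f g)\<^sup>*"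
      using b unfolding bad_def L1 L2 by auto
    moreover have "(?L - ?fault f g)\<^sup>* \<subseteq> (set es - ?fault f g)\<^sup>*" using LE by (intro rtrancl_mono) auto
    ultimately have r: "ps ! j \<in> (set es - ?fault f g)\<^sup>*" "ps ! j \<notin> (?L - {es ! e} - ?fault f g)\<^sup>*" by auto
    obtain s t where st: "ps ! j = (s, t)" by force
    then have "(s, t) \<in> set ps" using nth_mem[OF j] by simp
    then show "\<not> preserves 2 (set es) (set ps) (?L - {es ! e})"
      using r F c unfolding preserves_def st by blast
  next
    assume "\<not> preserves 2 (set es) (set ps) (?L - {es ! e})"
    then obtain s t F where st: "(s, t) \<in> set ps" and F: "F \<subseteq> set es" "finite F" "card F \<le> 2"
      and r: "(s, t) \<in> (set es - F)\<^sup>*" "(s, t) \<notin> (?L - {es ! e} - F)\<^sup>*"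
      unfolding preserves_def by blast
    have r': "(s, t) \<in> (?L - F)\<^sup>*" using pres st F r(1) unfolding preserves_def by blast
    obtain j where j: "j < length ps" "ps ! j = (s, t)" using st by (auto simp: in_set_conv_nth)
    obtain f g where fg: "f < length es + 1" "g < length es + 1" "?fault f g = F"
      using small_fault_indices[OF F(1,3)] by blast
    have "bad D e j f g" unfolding bad_def L1 L2 fg(3) j(2) using r(2) r' by simp
    then show "\<exists>j<length ps. \<exists>f<length es + 1. \<exists>g<length es + 1. bad D e j f g" using j(1) fg(1,2) by blast
  qed
qed

text \<open>The last conjunct refers to the edges live now, not to those live when \<open>i\<close>
  was examined; at the end it is therefore minimality.\<close>

definition pruned :: "nat \<Rightarrow> store \<Rightarrow> bool" where
  "pruned k \<tau> \<longleftrightarrow> (\<forall>i\<ge>k. arr \<tau> ''del'' i = 0) \<and>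
     output_list \<tau> = map ((!) es) (filter (\<lambda>i. arr \<tau> ''del'' i = 0) [0..<k]) \<and>
     preserves 2 (set es) (set ps) (live es (arr \<tau> ''del'') {}) \<and>
     (\<forall>i<k. arr \<tau> ''del'' i = 0 \<longrightarrow> \<not> preserves 2 (set es) (set ps) (live es (arr \<tau> ''del'') {} - {es ! i}))"

lemma wpt_prune_step:
  assumes inp: "input_in \<sigma>" and e: "scalar \<sigma> ''e'' = e" "e < length es" and pr: "pruned e \<sigma>"
  shows "wpt prune_step (all_tests_time + 30) (pruned (Suc e)) \<sigma>"
  unfolding prune_step_def
proof (rule wpt_Seq, rule wpt_weaken[OF wpt_agree[OF wpt_all_tests[OF inp refl e(1)]] order_refl])
  let ?D = "arr \<sigma> ''del''"
  let ?keep = "Seq (Store ''Hfst'' (Var ''h'') (Elem ''Efst'' (Var ''e'')))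
    (Seq (Store ''Hsnd'' (Var ''h'') (Elem ''Esnd'' (Var ''e''))) (Assign ''h'' (Add (Var ''h'') (Const 1))))"
  let ?drop = "Store ''del'' (Var ''e'') (Const 1)"
  fix \<tau>
  assume "agree (writes all_tests) (writes_arr all_tests) \<sigma> \<tau> \<and>
    (scalar \<tau> ''c'' \<noteq> 0 \<longleftrightarrow> (\<exists>j<length ps. \<exists>f<length es + 1. \<exists>g<length es + 1. bad ?D e j f g))"
  then have ag: "agree (writes all_tests) (writes_arr all_tests) \<sigma> \<tau>"
    and c: "scalar \<tau> ''c'' \<noteq> 0 \<longleftrightarrow> \<not> preserves 2 (set es) (set ps) (live es ?D {} - {es ! e})"
    using bad_iff[OF _ e(2), of ?D] pr unfolding pruned_def by blast+
  have inp': "input_in \<tau>" using inp ag by (rule input_in_agree) simp_all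
  have e': "scalar \<tau> ''e'' = e" and del: "arr \<tau> ''del'' = ?D" and out: "output_list \<tau> = output_list \<sigma>"
    using ag e(1) by (simp_all add: agree_def output_list_def)
  have E: "arr \<tau> ''Efst'' e = fst (es ! e)" "arr \<tau> ''Esnd'' e = snd (es ! e)"
    using inp' e(2) by (simp_all add: input_in_def nth_or_0_def)
  have De: "?D e = 0" using pr by (simp add: pruned_def)
  show "wpt (Cond (Var ''c'') ?keep ?drop) 30 (pruned (Suc e)) \<tau>"
  proof (rule wpt_Cond)
    assume "expr_val (Var ''c'') \<tau> \<noteq> 0"
    then have c': "\<not> preserves 2 (set es) (set ps) (live es ?D {} - {es ! e})" using c by simp
    define \<rho> where "\<rho> = set_scalar ''h'' (scalar \<tau> ''h'' + 1)
      (set_elem ''Hsnd'' (scalar \<tau> ''h'') (snd (es ! e)) (set_elem ''Hfst'' (scalar \<tau> ''h'') (fst (es ! e)) \<tau>))"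
    have "output_list \<rho> = output_list \<tau> @ [es ! e]"
      by (simp add: output_list_def \<rho>_def)
    then have "output_list \<rho> = map ((!) es) (filter (\<lambda>i. ?D i = 0) [0..<Suc e])"
      unfolding out using pr De by (simp add: pruned_def)
    moreover have "arr \<rho> ''del'' = ?D" by (simp add: \<rho>_def del)
    ultimately have "pruned (Suc e) \<rho>" using pr c' by (simp add: pruned_def less_Suc_eq)
    moreover have "wpt ?keep (4 + (4 + 4)) (\<lambda>\<tau>'. \<tau>' = \<rho>) \<tau>"
      by (intro wpt_Seq wpt_Store wpt_Assign) (simp_all add: \<rho>_def e' E)
    ultimately show "wpt ?keep (30 - (1 + expr_cost (Var ''c''))) (pruned (Suc e)) \<tau>"
      by (elim wpt_weaken) simp_all
  next
    assume "expr_val (Var ''c'') \<tau> = 0"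
    then have c': "preserves 2 (set es) (set ps) (live es ?D {} - {es ! e})" using c by simp
    let ?\<rho> = "set_elem ''del'' e 1 \<tau>"
    let ?D' = "?D(e := 1)"
    have L: "live es ?D' {} = live es ?D {} - {es ! e}"
    proof -
      have "live es ?D' {} = live es ?D {e}" by (auto simp: live_def split: if_splits)
      then show ?thesis using live_Un[of ?D "{}" "{e}"] e(2) by simp
    qed
    have "output_list ?\<rho> = map ((!) es) (filter (\<lambda>i. ?D' i = 0) [0..<Suc e])"
    proof -
      have "filter (\<lambda>i. ?D' i = 0) [0..<Suc e] = filter (\<lambda>i. ?D i = 0) [0..<e]"
        by (auto intro: filter_cong)
      moreover have "output_list ?\<rho> = output_list \<tau>" by (simp add: output_list_def)
      ultimately show ?thesis using out pr by (simp only: pruned_def)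
    qed
    moreover have "\<not> preserves 2 (set es) (set ps) (live es ?D' {} - {es ! i})" if i: "i < Suc e" "?D' i = 0" for i
    proof
      assume "preserves 2 (set es) (set ps) (live es ?D' {} - {es ! i})"
      \<comment> \<open>An edge that could be dropped now could, by monotonicity, have been dropped
        before \<open>e\<close> was deleted, against the invariant.\<close>
      then have "preserves 2 (set es) (set ps) (live es ?D {} - {es ! i})"
        by (rule preserves_mono) (use L in auto)
      moreover have "i < e" "?D i = 0" using i by (auto simp: less_Suc_eq split: if_splits)
      ultimately show False using pr by (simp add: pruned_def)
    qed
    moreover have "\<forall>i\<ge>Suc e. ?D' i = 0" using pr by (simp add: pruned_def)
    moreover have "preserves 2 (set es) (set ps) (live es ?D' {})" using c' L by simp
    moreover have "arr ?\<rho> ''del'' = ?D'" by (simp add: del)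
    ultimately have "pruned (Suc e) ?\<rho>" unfolding pruned_def by (simp only:) blast
    then show "wpt ?drop (30 - (1 + expr_cost (Var ''c''))) (pruned (Suc e)) \<tau>"
      by (intro wpt_Store) (simp_all add: e')
  qed simp
qed

lemma wpt_prune:
  "wpt prune ((length es + 1) * (all_tests_time + 30 + 10)) (pruned (length es)) (input_store n es ps)"
proof -
  let ?\<sigma> = "input_store n es ps"
  have inp: "input_in ?\<sigma>" by (simp add: input_in_def input_store_def)
  have "wpt prune ((length es + 1) * (all_tests_time + 30 + 10))
    (\<lambda>\<tau>. agree (insert ''e'' (writes prune_step)) (writes_arr prune_step) ?\<sigma> \<tau> \<and> pruned (length es) \<tau>) ?\<sigma>"
    unfolding prune_def
  proof (rule wpt_for_loop[where I = pruned])
    show "expr_val (Var ''m'') \<tau> = length es"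
      if "agree (insert ''e'' (writes prune_step)) (writes_arr prune_step) ?\<sigma> \<tau>" for \<tau>
      using that inp by (simp add: agree_def input_in_def)
    show "pruned k (set_scalar ''e'' v \<tau>)" if "pruned k \<tau>" for k v \<tau>
      using that by (simp add: pruned_def output_list_def)
    have "live es (\<lambda>_. 0) {} = set es" by (auto simp: live_def set_conv_nth)
    then show "pruned 0 ?\<sigma>"
      by (simp add: pruned_def input_store_def output_list_def preserves_def)
    fix k \<tau>
    assume k: "k < length es" "scalar \<tau> ''e'' = k" "pruned k \<tau>"
      and ag: "agree (insert ''e'' (writes prune_step)) (writes_arr prune_step) ?\<sigma> \<tau>"
    have "input_in \<tau>" using inp ag by (rule input_in_agree) simp_all
    then show "wpt prune_step (all_tests_time + 30) (pruned (Suc k)) \<tau>"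
      using k by (intro wpt_prune_step)
  qed simp_all
  then show ?thesis by (rule wpt_weaken) simp_all
qed

text \<open>The six nested loops over \<open>e\<close>, \<open>j\<close>, \<open>f\<close>,
  \<open>g\<close>, \<open>r\<close> and \<open>i\<close> contribute one factor each. The summand 2
  covers the two fault loops: one for their extra index \<open>length es\<close>, one for the
  additional round in the loop bound.\<close>

lemma prune_time_bound:
  "(length es + 1) * (all_tests_time + 30 + 10) \<le> 244 * (2 + (n + length es + length ps)) ^ 6"
proof -
  define M where "M = 2 + (n + length es + length ps)"
  have M: "n + 1 \<le> M" "length es + 1 \<le> M" "length es + 1 + 1 \<le> M" "length ps + 1 \<le> M" "1 \<le> M"
    by (simp_all add: M_def)
  have pow: "1 \<le> M ^ k" for k using M(5) by simp
  \<comment> \<open>\<open>times\<close> accounts for a loop by raising the exponent;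
    \<open>plus\<close> absorbs a constant overhead into the coefficient.\<close>
  have times: "a * b \<le> c * M ^ k'" if "a \<le> M" "b \<le> c * M ^ k" "k' = Suc k" for a b c k k'
    using mult_mono[OF that(1,2)] that(3) by (simp add: mult_ac)
  have plus: "b + d \<le> c' * M ^ k" if "b \<le> c * M ^ k" "c' = c + d" for b c c' d k
  proof -
    have "d * 1 \<le> d * M ^ k" using pow by (rule mult_le_mono2)
    then have "b + d \<le> c * M ^ k + d * M ^ k" using that(1) by linarith
    then show ?thesis using that(2) by (simp add: add_mult_distrib)
  qed
  let ?Tt = "2 + (search_time + (4 + (2 + (search_time + 10))))"
  let ?Tg = "(length es + 1 + 1) * (?Tt + 10)" and ?Tf = "\<lambda>g. (length es + 1 + 1) * (g + 10)"
  have "(length es + 1) * (40 + 10) \<le> 50 * M ^ 1" using M(2) by simp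
  then have "(length es + 1) * (40 + 10) + 10 \<le> 60 * M ^ 1" by (rule plus) simp
  with M(2) have r: "(length es + 1) * ((length es + 1) * (40 + 10) + 10) \<le> 60 * M ^ 2" by (rule times) simp
  have "3 + 10 \<le> 13 * M ^ 1" using M(5) by simp
  with M(1) have "(n + 1) * (3 + 10) \<le> 13 * M ^ 2" by (rule times) simp
  moreover have "4 \<le> 4 * M ^ 2" using pow[of 2] by simp
  ultimately have "search_time \<le> 13 * M ^ 2 + (4 * M ^ 2 + 60 * M ^ 2)"
    unfolding search_time_def using r by (intro add_mono)
  then have "?Tt + 10 \<le> 182 * M ^ 2" using pow[of 2] by linarith
  with M(3) have "?Tg \<le> 182 * M ^ 3" by (rule times) simp
  then have "?Tg + 10 \<le> 192 * M ^ 3" by (rule plus) simp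
  with M(3) have "?Tf ?Tg \<le> 192 * M ^ 4" by (rule times) simp
  then have "?Tf ?Tg + 10 \<le> 202 * M ^ 4" by (rule plus) simp
  with M(4) have "(length ps + 1) * (?Tf ?Tg + 10) \<le> 202 * M ^ 5" by (rule times) simp
  then have "(length ps + 1) * (?Tf ?Tg + 10) + 2 \<le> 204 * M ^ 5" by (rule plus) simp
  then have "all_tests_time \<le> 204 * M ^ 5" unfolding all_tests_time_def by (simp only: add.commute)
  then have "all_tests_time + 30 \<le> 234 * M ^ 5" by (rule plus) simp
  then have "all_tests_time + 30 + 10 \<le> 244 * M ^ 5" by (rule plus) simp
  with M(2) have "(length es + 1) * (all_tests_time + 30 + 10) \<le> 244 * M ^ 6" by (rule times) simp
  then show ?thesis unfolding M_def .
qed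

end

section \<open>Existence and polynomial-time construction\<close>

theorem theorem6p1:
  shows "\<exists>(c :: real) (C :: real). c > 0 \<and> C > 0 \<and>
    (\<forall>(G :: 'a pair_pre_digraph) P.
       pair_fin_digraph G \<and> P \<subseteq> pverts G \<times> pverts G \<longrightarrow>
       (\<exists>H. ft_reach_subgraph_slack c 2 G P H \<and>
            real (card (parcs H)) \<le>
              C * real (card (pverts G)) powr (4 / 3) * real (card P) powr (1 / 3))) \<and>
    poly_time_constructs (\<lambda>G P H.
       ft_reach_subgraph_slack c 2 G P H \<and>
       real (card (parcs H)) \<le>
         C * real (card (pverts G)) powr (4 / 3) * real (card P) powr (1 / 3))"
\<comment> \<open>All pairs are kept, so \<open>c\<close> is 1; \<open>C\<close> is the constant
  from \<open>card_all_critical_powr\<close>.\<close>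
proof (rule exI[of _ 1], rule exI[of _ 812], intro conjI allI impI)
  fix G :: "'a pair_pre_digraph" and P
  assume GP: "pair_fin_digraph G \<and> P \<subseteq> pverts G \<times> pverts G"
  then interpret pair_fin_digraph G by simp
  obtain X where X: "X \<subseteq> parcs G" "preserves 2 (parcs G) P X" "\<forall>e \<in> X. \<not> preserves 2 (parcs G) P (X - {e})"
    by (rule minimal_preserver_exists[where k = 2 and P = P, OF pair_finite_arcs])
  let ?H = "\<lparr> pverts = pverts G, parcs = X \<rparr>"
  have "ft_reach_subgraph_slack 1 2 G P ?H \<and>
    real (card (parcs ?H)) \<le> 812 * real (card (pverts G)) powr (4 / 3) * real (card P) powr (1 / 3)"
    using GP X by (intro minimal_preserver) simp_all
  then show "\<exists>H. ft_reach_subgraph_slack 1 2 G P H \<and>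
    real (card (parcs H)) \<le> 812 * real (card (pverts G)) powr (4 / 3) * real (card P) powr (1 / 3)" by (rule exI)
next
  show "poly_time_constructs (\<lambda>G P H. ft_reach_subgraph_slack 1 2 G P H \<and>
    real (card (parcs H)) \<le> 812 * real (card (pverts G)) powr (4 / 3) * real (card P) powr (1 / 3))"
    unfolding poly_time_constructs_def
  proof (rule exI[of _ prune], rule exI[of _ "smult 244 ([:2, 1:] ^ 6)"], intro allI impI)
    fix n :: nat and es ps :: "(nat \<times> nat) list"
    assume A: "distinct es \<and> set es \<subseteq> {..<n} \<times> {..<n} \<and> distinct ps \<and> set ps \<subseteq> {..<n} \<times> {..<n}"
    then interpret pruning n es ps by unfold_locales simp_all
    \<comment> \<open>The bound of \<open>prune_time_bound\<close>, written as a polynomial in the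
      input size.\<close>
    let ?b = "smult 244 ([:2, 1:] ^ 6) :: nat poly"
    have b: "poly ?b k = 244 * (2 + k) ^ 6" for k by simp
    obtain t \<sigma> where t: "exec prune (input_store n es ps) t \<sigma>" "t \<le> poly ?b (n + length es + length ps)"
      and pr: "pruned (length es) \<sigma>"
      using wpt_prune prune_time_bound unfolding wpt_def b by (meson le_trans)
    let ?D = "arr \<sigma> ''del''" and ?G = "list_digraph n es" and ?H = "list_digraph n (output_list \<sigma>)"
    have out: "output_list \<sigma> = map ((!) es) (filter (\<lambda>i. ?D i = 0) [0..<length es])"
      using pr by (simp add: pruned_def)
    have set: "set (output_list \<sigma>) = live es ?D {}" unfolding out by (auto simp: live_def)
    have dist: "distinct (output_list \<sigma>)"
      unfolding out distinct_map using es(1) by (auto simp: inj_on_def nth_eq_iff_index_eq)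
    have "ft_reach_subgraph_slack 1 2 ?G (set ps) ?H \<and>
      real (card (parcs ?H)) \<le> 812 * real (card (pverts ?G)) powr (4 / 3) * real (card (set ps)) powr (1 / 3)"
    proof (rule minimal_preserver)
      show "pair_fin_digraph ?G" using es(2) by unfold_locales (auto simp: list_digraph_def)
      show "pverts ?H = pverts ?G" by (simp add: list_digraph_def)
      show "parcs ?H \<subseteq> parcs ?G" unfolding list_digraph_def set by (auto simp: live_def)
      show "set ps \<subseteq> pverts ?G \<times> pverts ?G" using A by (simp add: list_digraph_def)
      have arcs: "parcs ?G = set es" "parcs ?H = live es ?D {}" unfolding set[symmetric] by (simp_all add: list_digraph_def)
      show "preserves 2 (parcs ?G) (set ps) (parcs ?H)" unfolding arcs using pr unfolding pruned_def by blast
      show "\<not> preserves 2 (parcs ?G) (set ps) (parcs ?H - {e})" if e: "e \<in> parcs ?H" for e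
      proof -
        obtain i where "i < length es" "?D i = 0" "e = es ! i" using e unfolding arcs live_def by blast
        then show ?thesis unfolding arcs using pr unfolding pruned_def by blast
      qed
    qed
    then show "\<exists>t \<sigma>. exec prune (input_store n es ps) t \<sigma> \<and> t \<le> poly ?b (n + length es + length ps) \<and>
      distinct (output_list \<sigma>) \<and> ft_reach_subgraph_slack 1 2 ?G (set ps) (list_digraph n (output_list \<sigma>)) \<and>
      real (card (parcs (list_digraph n (output_list \<sigma>)))) \<le>
        812 * real (card (pverts ?G)) powr (4 / 3) * real (card (set ps)) powr (1 / 3)"
      using t dist by blast
  qed
qed simp_all

end
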